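(* Let $p$ be a prime, let $a$ be an integer with $\gcd(a,p)=1$, and let $g$ be an integer of multiplicative order $t$ modulo $p$. Let $U,V$ be real numbers with $U,V\le t$ and $U^3V\ge p^{5/2}$. Then $$N_{a,g,p}(U,V) = \frac{6}{\pi^2}\cdot\frac{UV}{p} + O\left(\left(\frac{U^{3/4}V^{1/4}}{p^{1/8}} + U^{1/4}V^{5/8}\right)p^{o(1)}\right).$$
   Context: For a prime $p$, integers $a,g$ and real $U,V$, let $\mathcal{E}_{a,g,p}(U,V)$ be the set of integer pairs $(x,y)\in[1,U]\times[1,V]$ with $y\equiv a g^x \pmod p$. $N_{a,g,p}(U,V)$ denotes the number of pairs $(x,y)\in\mathcal{E}_{a,g,p}(U,V)$ with $\gcd(x,y)=1$ (the "visible points"). The notation $p^{o(1)}$ denotes a factor which, for every fixed $\varepsilon>0$, is at most $p^{\varepsilon}$ for all sufficiently large $p$; the implied constant in $O(\cdot)$ is absolute (may depend on $\varepsilon$). *)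

theory Defs
  imports "HOL-Analysis.Analysis" "HOL-Number_Theory.Number_Theory"
begin

text \<open>The points of the exponential curve \<open>y \<equiv> a g\<^sup>x (mod p)\<close> in the box \<open>[1,U] \<times> [1,V]\<close>.
  Since \<open>x \<ge> 1\<close> on this set, \<open>nat x\<close> is the genuine exponent \<open>x\<close>.\<close>

definition exp_curve_points :: "int \<Rightarrow> int \<Rightarrow> nat \<Rightarrow> real \<Rightarrow> real \<Rightarrow> (int \<times> int) set" where
  "exp_curve_points a g p U V =
     {(x, y). real_of_int x \<in> {1..U} \<and> real_of_int y \<in> {1..V} \<and> [y = a * g ^ nat x] (mod int p)}"

definition visible_count :: "int \<Rightarrow> int \<Rightarrow> nat \<Rightarrow> real \<Rightarrow> real \<Rightarrow> nat" where
  "visible_count a g p U V = card {(x, y) \<in> exp_curve_points a g p U V. gcd x y = 1}"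

end

theory Submission
  imports Defs "HOL-Computational_Algebra.Squarefree"
begin

text \<open>
  Moebius inversion writes the count as \<open>\<Sum>d. \<mu>(d) M\<^sub>d\<close>, where \<open>M\<^sub>d\<close> counts the points
  whose coordinates are both divisible by \<open>d\<close>. Put \<open>D = U\<^bsup>3/4\<^esup> V\<^bsup>1/4\<^esup> p\<^bsup>-5/8\<^esup>\<close>, which is at least 1
  by hypothesis.

  For \<open>d \<le> D\<close>, completing both variables and bounding
  \<open>\<Sum>u. e(c h\<^sup>u / p) e(k u / \<tau>)\<close> by \<open>\<surd>p\<close> gives \<open>M\<^sub>d = UV / (d\<^sup>2 p)\<close> up to \<open>p\<^bsup>1/2 + o(1)\<^esup>\<close>.

  For medium \<open>d\<close>, multiply \<open>k\<close> points \<open>(du, dv)\<close>: the product of the \<open>v\<close>'s is determined modulo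
  \<open>p\<close> by the sum of the \<open>u\<close>'s, and by the divisor bound an integer is such a product in
  \<open>p\<^bsup>o(1)\<^esup>\<close> ways, so \<open>M\<^sub>d\<^sup>k \<le> p\<^bsup>o(1)\<^esup> (U/d) ((V/d)\<^sup>k / p + 1)\<close>. This is used with \<open>k = 2\<close> up to
  \<open>V\<^bsup>5/4\<^esup> U\<^bsup>-1/2\<^esup>\<close> and with \<open>k = 3\<close> up to \<open>U\<^bsup>1/2\<^esup> V\<^bsup>1/4\<^esup>\<close>.

  For larger \<open>d\<close>, fix \<open>u\<close> and \<open>v\<close> instead: two solutions \<open>d\<^sub>1, d\<^sub>2\<close> of \<open>d v \<equiv> a g\<^bsup>du\<^esup>\<close> are
  determined by their difference, so there are \<open>O((U/u)\<^bsup>1/2\<^esup>)\<close> of them.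

  If \<open>V \<le> U\<close> and \<open>UV \<le> p\<^bsup>3/2\<^esup>\<close>, the product bound for \<open>d = 1\<close>, \<open>k = 2\<close> already shows that the count
  and the main term are both within the error.
\<close>

section \<open>Additive characters and completion\<close>

lemma coprime_int_nat_mod:
  fixes g :: int
  assumes "p > 0"
  shows "coprime p (nat (g mod int p)) \<longleftrightarrow> coprime g (int p)"
proof -
  have "coprime g (int p) \<longleftrightarrow> coprime (g mod int p) (int p)"
    using assms by (simp add: coprime_mod_left_iff)
  also have "g mod int p = int (nat (g mod int p))" using assms by simp
  also have "coprime \<dots> (int p) \<longleftrightarrow> coprime (nat (g mod int p)) p"
    by (rule coprime_int_iff)
  finally show ?thesis by (simp add: coprime_commute)
qed

text \<open>Passing to the residue \<open>nat (g mod int p)\<close> gives access to the facts about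
  \<open>ord\<close> on natural numbers.\<close>

lemma ord_int_eq_ord_nat:
  fixes g :: int and p :: nat
  assumes "p > 0"
  shows "ord (int p) g = ord p (nat (g mod int p))"
proof -
  define g' where "g' = nat (g mod int p)"
  have g': "int g' = g mod int p" using assms by (simp add: g'_def)
  have 1: "coprime (int p) g \<longleftrightarrow> coprime p g'"
    using coprime_int_nat_mod[OF assms, of g] by (simp add: g'_def coprime_commute)
  have 2: "[g ^ d = 1] (mod int p) \<longleftrightarrow> [g' ^ d = 1] (mod p)" for d
  proof -
    have "[g ^ d = 1] (mod int p) \<longleftrightarrow> [(g mod int p) ^ d = 1] (mod int p)"
      by (simp add: cong_def power_mod)
    also have "\<dots> \<longleftrightarrow> [int (g' ^ d) = int 1] (mod int p)"
      by (simp add: g')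
    also have "\<dots> \<longleftrightarrow> [g' ^ d = 1] (mod p)" by (rule cong_int_iff)
    finally show ?thesis .
  qed
  show ?thesis unfolding ord_def g'_def[symmetric] by (simp add: 1 2)
qed

lemma ord_int_power_cong_iff:
  fixes g :: int
  assumes "coprime g (int p)" "p > 0"
  shows "[g ^ i = g ^ j] (mod int p) \<longleftrightarrow> [i = j] (mod ord (int p) g)"
proof -
  define g' where "g' = nat (g mod int p)"
  have g': "int g' = g mod int p" using assms by (simp add: g'_def)
  have 1: "coprime p g'"
    using coprime_int_nat_mod[OF assms(2), of g] assms(1) by (simp add: g'_def)
  have "[g ^ i = g ^ j] (mod int p) \<longleftrightarrow> [(g mod int p) ^ i = (g mod int p) ^ j] (mod int p)"
    by (simp add: cong_def power_mod)
  also have "\<dots> \<longleftrightarrow> [int (g' ^ i) = int (g' ^ j)] (mod int p)"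
    by (simp add: g')
  also have "\<dots> \<longleftrightarrow> [g' ^ i = g' ^ j] (mod p)" by (rule cong_int_iff)
  also have "\<dots> \<longleftrightarrow> [i = j] (mod ord (int p) g)"
    unfolding ord_int_eq_ord_nat[OF assms(2)] g'_def[symmetric] by (rule order_divides_expdiff[OF 1])
  finally show ?thesis .
qed

lemma ord_int_bounds:
  fixes g :: int
  assumes "coprime g (int p)" "prime p"
  shows "0 < ord (int p) g" "ord (int p) g < p"
proof -
  have p: "p > 0" using assms(2) prime_gt_0_nat by blast
  define g' where "g' = nat (g mod int p)"
  have 1: "coprime p g'"
    using coprime_int_nat_mod[OF p, of g] assms(1) by (simp add: g'_def)
  have e: "ord (int p) g = ord p g'" unfolding g'_def by (rule ord_int_eq_ord_nat[OF p])
  show "0 < ord (int p) g" unfolding e using 1 by simp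
  have "ord p g' dvd totient p" by (rule order_divides_totient[OF 1])
  then have "ord p g' \<le> p - 1" using assms(2) prime_gt_1_nat[OF assms(2)]
    by (auto simp: totient_prime dest: dvd_imp_le)
  then show "ord (int p) g < p" unfolding e using p by linarith
qed

section \<open>Additive characters and their orthogonality\<close>

text \<open>This is e(k/n) = exp(2 pi i k/n). For \<open>n = 0\<close>, division by zero makes it
  constantly 1, so additivity and unimodularity hold for every \<open>n\<close>.\<close>

definition add_char :: "nat \<Rightarrow> int \<Rightarrow> complex" where
  "add_char n k = cis (2 * pi * (real_of_int k / real n))"

lemma add_char_add: "add_char n (j + k) = add_char n j * add_char n k"
  by (simp add: add_char_def cis_mult add_divide_distrib ring_distribs)

lemma add_char_0 [simp]: "add_char n 0 = 1"
  by (simp add: add_char_def)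

lemma norm_add_char [simp]: "norm (add_char n k) = 1"
  by (simp add: add_char_def)

lemma cnj_add_char: "cnj (add_char n k) = add_char n (- k)"
  by (simp add: add_char_def cis_cnj)

lemma add_char_power: "add_char n k ^ m = add_char n (k * int m)"
proof -
  have "real m * (2 * pi * (real_of_int k / real n)) = 2 * pi * (real_of_int (k * int m) / real n)"
    by simp
  then show ?thesis unfolding add_char_def Complex.DeMoivre by (rule arg_cong)
qed

lemma add_char_multiple: "add_char n (int n * k) = 1"
proof (cases "n = 0")
  case False
  then show ?thesis using cis_multiple_2pi[of "real_of_int k"] by (simp add: add_char_def)
qed simp

lemma add_char_cong:
  assumes "[j = k] (mod int n)" shows "add_char n j = add_char n k"
proof -
  obtain m where "j = k + int n * m"
    using cong_sym[OF assms] unfolding cong_iff_lin by blast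
  then show ?thesis by (simp add: add_char_add add_char_multiple)
qed

lemma norm_one_minus_add_char: "norm (1 - add_char n k) = 2 * \<bar>sin (pi * real_of_int k / real n)\<bar>"
proof -
  define x where "x = pi * real_of_int k / real n"
  have "norm (1 - add_char n k) ^ 2 = (2 * \<bar>sin x\<bar>) ^ 2"
  proof -
    have "add_char n k = cis (2 * x)" by (simp add: add_char_def x_def mult.assoc)
    then have "norm (1 - add_char n k) ^ 2 = (1 - cos (2 * x)) ^ 2 + (sin (2 * x)) ^ 2"
      by (simp add: cmod_power2)
    also have "\<dots> = 2 - 2 * cos (2 * x)"
      using sin_cos_squared_add[of "2 * x"] by (simp add: power2_eq_square algebra_simps)
    also have "\<dots> = (2 * \<bar>sin x\<bar>) ^ 2"
      by (simp add: cos_double_sin power_mult_distrib)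
    finally show ?thesis .
  qed
  then show ?thesis unfolding x_def by (rule power2_eq_imp_eq) auto
qed

lemma add_char_eq_1_iff:
  assumes "n > 0" shows "add_char n k = 1 \<longleftrightarrow> int n dvd k"
proof
  assume "add_char n k = 1"
  then have "sin (pi * real_of_int k / real n) = 0"
    using norm_one_minus_add_char[of n k] by simp
  then obtain i :: int where i: "pi * real_of_int k / real n = of_int i * pi"
    using sin_zero_iff_int2 by blast
  then have "real_of_int k = real_of_int (i * int n)"
    using assms by (simp add: field_simps)
  then have "k = i * int n" by linarith
  then show "int n dvd k" by simp
next
  assume "int n dvd k"
  then show "add_char n k = 1" using add_char_multiple by (auto elim!: dvdE)
qed

lemma sum_add_char:
  assumes "n > 0"
  shows "(\<Sum>j\<in>{1..n}. add_char n (k * int j)) = (if int n dvd k then of_nat n else 0)"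
proof (cases "int n dvd k")
  case True
  then have "int n dvd k * int j" for j by simp
  then have "add_char n (k * int j) = 1" for j using add_char_eq_1_iff[OF assms] by blast
  then show ?thesis using True by simp
next
  case False
  define z where "z = add_char n k"
  have z1: "z \<noteq> 1" using False assms by (simp add: z_def add_char_eq_1_iff)
  have zn: "z ^ n = 1"
    using add_char_multiple[of n k] by (simp add: z_def add_char_power mult.commute)
  have "(\<Sum>j\<in>{1..n}. add_char n (k * int j)) = (\<Sum>j\<in>{1..n}. z ^ j)"
    by (simp add: z_def add_char_power)
  also have "\<dots> = (\<Sum>j<n. z ^ Suc j)"
    by (rule sum.reindex_bij_witness[of _ Suc "\<lambda>j. j - 1"]) auto
  also have "\<dots> = z * (\<Sum>j<n. z ^ j)" by (simp add: sum_distrib_left)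
  also have "(\<Sum>j<n. z ^ j) = 0" using z1 zn by (simp add: sum_gp_strict)
  finally show ?thesis using False by simp
qed

lemma sum_add_char_residues:
  assumes "n > 0"
  shows "(\<Sum>k<n. add_char n (m * int k)) = (if int n dvd m then of_nat n else 0)"
proof -
  have "(\<Sum>k<n. add_char n (m * int k)) = (\<Sum>j\<in>{1..n}. add_char n (m * int (j - 1)))"
    by (rule sum.reindex_bij_witness[of _ "\<lambda>j. j - 1" Suc]) auto
  also have "\<dots> = (\<Sum>j\<in>{1..n}. add_char n (- m) * add_char n (m * int j))"
    by (intro sum.cong) (auto simp: add_char_add[symmetric] of_nat_diff algebra_simps)
  also have "\<dots> = add_char n (- m) * (if int n dvd m then of_nat n else 0)"
    unfolding sum_distrib_left[symmetric] sum_add_char[OF assms] ..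
  also have "\<dots> = (if int n dvd m then of_nat n else 0)"
    using add_char_eq_1_iff[OF assms, of "- m"] by auto
  finally show ?thesis .
qed

section \<open>Cancellation in geometric sums, and completion\<close>

text \<open>The function sin x - x cos x vanishes at 0 and has derivative x sin x, which is
  nonnegative on [0, pi].\<close>

lemma mult_cos_le_sin:
  assumes "0 \<le> x" "x \<le> pi" shows "x * cos x \<le> sin (x::real)"
proof -
  have "(\<lambda>x. sin x - x * cos x) 0 \<le> (\<lambda>x. sin x - x * cos x) x"
  proof (rule DERIV_nonneg_imp_nondecreasing[OF assms(1)])
    fix y :: real assume y: "0 \<le> y" "y \<le> x"
    have "((\<lambda>x. sin x - x * cos x) has_real_derivative y * sin y) (at y)"
      by (auto intro!: derivative_eq_intros)
    moreover have "0 \<le> y * sin y" using y assms by (intro mult_nonneg_nonneg sin_ge_zero) auto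
    ultimately show "\<exists>d. ((\<lambda>x. sin x - x * cos x) has_real_derivative d) (at y) \<and> 0 \<le> d"
      by blast
  qed
  then show ?thesis by simp
qed

text \<open>A weak form of Jordan's inequality: with y = x/2, sin x = 2 sin y cos y >= 2 y (cos
  y)^2, and (cos y)^2 >= 1/2 for y up to pi/4.\<close>

lemma half_le_sin:
  assumes "0 \<le> x" "x \<le> pi / 2" shows "x / 2 \<le> sin (x::real)"
proof -
  define y where "y = x / 2"
  have y: "0 \<le> y" "y \<le> pi / 4" "x = 2 * y" using assms by (auto simp: y_def)
  have "cos (pi / 4) \<le> cos y" using y by (intro cos_monotone_0_pi_le) auto
  then have c: "sqrt 2 / 2 \<le> cos y" by (simp add: cos_45)
  have "(sqrt 2 / 2) ^ 2 \<le> cos y ^ 2" by (rule power_mono[OF c]) simp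
  then have c2: "1 / 2 \<le> cos y ^ 2" by (simp add: power_divide)
  have c0: "0 \<le> cos y" using c real_sqrt_ge_zero[of 2] by linarith
  have "x / 2 = 2 * y * (1 / 2)" using y by simp
  also have "\<dots> \<le> 2 * y * cos y ^ 2" using c2 y by (intro mult_left_mono) auto
  also have "\<dots> = 2 * (y * cos y) * cos y" by (simp add: power2_eq_square)
  also have "\<dots> \<le> 2 * sin y * cos y"
    using mult_cos_le_sin[of y] y c0 by (intro mult_right_mono mult_left_mono) auto
  also have "\<dots> = sin x" using y by (simp add: sin_double)
  finally show ?thesis .
qed

text \<open>The left side is the distance from k/n to the nearest integer. Up to n/2 the bound comes
  from \<open>half_le_sin\<close>; beyond that, the symmetry of the sine about pi/2 replaces k by n
  - k.\<close>

lemma norm_one_minus_add_char_ge: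
  assumes "0 < k" "k < n"
  shows "min (real k) (real (n - k)) / real n \<le> norm (1 - add_char n (int k))"
proof -
  have n: "real n > 0" using assms by simp
  have *: "real j / real n \<le> 2 * sin (pi * real j / real n)" if "2 * j \<le> n" for j :: nat
  proof -
    have "2 * real j \<le> real n" using that by linarith
    then have "pi * (real j / real n) / 2 \<le> sin (pi * (real j / real n))"
      using n by (intro half_le_sin) (auto simp: field_simps)
    moreover have "1 * (real j / real n) \<le> pi * (real j / real n)"
      using pi_gt3 by (intro mult_right_mono) auto
    ultimately show ?thesis by simp
  qed
  have s: "sin (pi * real (n - k) / real n) = sin (pi * real k / real n)"
  proof -
    have "pi * real (n - k) / real n = pi - pi * real k / real n"
      using assms by (simp add: of_nat_diff field_simps)
    then show ?thesis by simp
  qed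
  have "min (real k) (real (n - k)) / real n \<le> 2 * sin (pi * real k / real n)"
  proof (cases "2 * k \<le> n")
    case True
    have "min (real k) (real (n - k)) / real n \<le> real k / real n"
      using n by (intro divide_right_mono) auto
    with *[OF True] show ?thesis by linarith
  next
    case False
    have "min (real k) (real (n - k)) / real n \<le> real (n - k) / real n"
      using n by (intro divide_right_mono) auto
    with *[of "n - k"] s False show ?thesis by simp
  qed
  then show ?thesis unfolding norm_one_minus_add_char by simp
qed

text \<open>A geometric series whose numerator is at most 2. The reciprocal of the minimum is
  weakened to a sum of two reciprocals, so that summing over k later produces two harmonic
  sums.\<close>

lemma norm_sum_add_char_interval_le:
  assumes "0 < k" "k < n"
  shows "norm (\<Sum>j\<in>{1..K}. add_char n (int k * int j)) \<le> 2 * real n * (1 / real k + 1 / real (n - k))"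
proof -
  define z where "z = add_char n (int k)"
  have z1: "norm (1 - z) > 0"
    using assms add_char_eq_1_iff[of n "int k"] by (auto simp: z_def dest: zdvd_imp_le)
  have "(\<Sum>j\<in>{1..K}. add_char n (int k * int j)) = (\<Sum>j<K. z ^ Suc j)"
    unfolding z_def add_char_power
    by (rule sum.reindex_bij_witness[of _ Suc "\<lambda>j. j - 1"]) (auto)
  also have "\<dots> = z * (\<Sum>j<K. z ^ j)" by (simp add: sum_distrib_left)
  also have "(\<Sum>j<K. z ^ j) = (1 - z ^ K) / (1 - z)"
    using z1 by (auto simp: sum_gp_strict)
  finally have "norm (\<Sum>j\<in>{1..K}. add_char n (int k * int j)) = norm (1 - z ^ K) / norm (1 - z)"
    by (simp add: norm_mult norm_divide z_def)
  also have "\<dots> \<le> 2 / norm (1 - z)"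
  proof (rule divide_right_mono)
    have "norm (1 - z ^ K) \<le> norm (1::complex) + norm (z ^ K)" by (rule norm_triangle_ineq4)
    then show "norm (1 - z ^ K) \<le> 2" by (simp add: z_def add_char_power)
  qed simp
  also have "\<dots> \<le> 2 / (min (real k) (real (n - k)) / real n)"
    unfolding z_def using norm_one_minus_add_char_ge[OF assms] assms z1
    by (intro divide_left_mono mult_pos_pos divide_pos_pos) (auto simp: z_def)
  also have "\<dots> = 2 * real n * (1 / min (real k) (real (n - k)))" by simp
  also have "\<dots> \<le> 2 * real n * (1 / real k + 1 / real (n - k))"
    using assms by (intro mult_left_mono) (auto simp: min_def)
  finally show ?thesis .
qed

text \<open>Expanding the indicator of {1..K} in characters modulo n writes the incomplete sum as
  the average over k of \<open>F k * cnj (W k)\<close>. Every complete sum \<open>F k\<close> is at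
  most B, and the \<open>W k\<close> have total size at most n (1 + 4 harm n).\<close>

lemma completion_bound:
  fixes f :: "nat \<Rightarrow> complex"
  assumes n: "n > 0" and K: "K \<le> n"
    and B: "\<And>k. norm (\<Sum>j\<in>{1..n}. f j * add_char n (int k * int j)) \<le> B"
  shows "norm (\<Sum>j\<in>{1..K}. f j) \<le> B * (1 + 4 * harm n)"
proof -
  define F where "F k = (\<Sum>j\<in>{1..n}. f j * add_char n (int k * int j))" for k :: nat
  define W where "W k = (\<Sum>j\<in>{1..K}. add_char n (int k * int j))" for k :: nat
  have B0: "B \<ge> 0" using norm_ge_zero[of "F 0"] B[of 0] unfolding F_def by linarith
  have "(\<Sum>k<n. F k * cnj (W k)) =
      (\<Sum>k<n. \<Sum>j\<in>{1..n}. \<Sum>i\<in>{1..K}. f j * add_char n ((int j - int i) * int k))"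
    unfolding F_def W_def cnj_sum sum_product
    by (intro sum.cong refl) (simp add: cnj_add_char add_char_add[symmetric] mult.assoc algebra_simps)
  also have "\<dots> = (\<Sum>j\<in>{1..n}. \<Sum>i\<in>{1..K}. \<Sum>k<n. f j * add_char n ((int j - int i) * int k))"
    by (subst sum.swap, rule sum.cong[OF refl], rule sum.swap)
  also have "\<dots> = (\<Sum>j\<in>{1..n}. \<Sum>i\<in>{1..K}. f j * (if i = j then of_nat n else 0))"
  proof (intro sum.cong refl)
    fix j i assume ji: "j \<in> {1..n}" "i \<in> {1..K}"
    \<comment> \<open>Since K <= n, both indices lie in {1..n}, so a congruence modulo n between
      them is an equality.\<close>
    have "int n dvd int j - int i \<longleftrightarrow> i = j"
    proof
      assume "int n dvd int j - int i"
      show "i = j"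
      proof (rule ccontr)
        assume "i \<noteq> j"
        then have "int n \<le> \<bar>int j - int i\<bar>"
          using \<open>int n dvd int j - int i\<close>
          by (intro zdvd_imp_le) auto
        then show False using ji K by auto
      qed
    qed simp
    then show "(\<Sum>k<n. f j * add_char n ((int j - int i) * int k)) = f j * (if i = j then of_nat n else 0)"
      unfolding sum_distrib_left[symmetric] sum_add_char_residues[OF n] by simp
  qed
  also have "\<dots> = (\<Sum>j\<in>{1..n}. if j \<in> {1..K} then f j * of_nat n else 0)"
    by (intro sum.cong refl) (simp add: sum_distrib_left[symmetric] if_distrib cong: if_cong)
  also have "\<dots> = (\<Sum>j\<in>{1..K}. f j) * of_nat n"
    using K by (subst sum.inter_restrict[symmetric]) (auto simp: sum_distrib_right Int_absorb1 intro!: sum.cong)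
  finally have eq: "(\<Sum>j\<in>{1..K}. f j) * of_nat n = (\<Sum>k<n. F k * cnj (W k))" ..
  have "real n * norm (\<Sum>j\<in>{1..K}. f j) = norm (\<Sum>k<n. F k * cnj (W k))"
    unfolding eq[symmetric] by (simp add: norm_mult)
  also have "\<dots> \<le> (\<Sum>k<n. norm (F k * cnj (W k)))" by (rule norm_sum)
  also have "\<dots> \<le> (\<Sum>k<n. B * norm (W k))"
    using B unfolding F_def by (intro sum_mono) (auto simp: norm_mult intro!: mult_right_mono)
  also have "\<dots> = B * (\<Sum>k<n. norm (W k))" by (simp add: sum_distrib_left)
  finally have *: "real n * norm (\<Sum>j\<in>{1..K}. f j) \<le> B * (\<Sum>k<n. norm (W k))" .
  have "(\<Sum>k<n. norm (W k)) \<le> real n * (1 + 4 * harm n)"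
  proof -
    have h: "(\<Sum>k\<in>{1..<n}. 1 / real k) \<le> harm n"
      unfolding harm_def inverse_eq_divide by (intro sum_mono2) auto
    \<comment> \<open>Frequency 0 gives the trivial term K <= n; the substitution k -> n - k
      identifies the two harmonic sums given by the other frequencies.\<close>
    have "{..<n} = insert 0 {1..<n}" using n by auto
    then have "(\<Sum>k<n. norm (W k)) = norm (W 0) + (\<Sum>k\<in>{1..<n}. norm (W k))" by simp
    also have "norm (W 0) \<le> real n" using K by (simp add: W_def)
    also have "(\<Sum>k\<in>{1..<n}. norm (W k)) \<le> (\<Sum>k\<in>{1..<n}. 2 * real n * (1 / real k + 1 / real (n - k)))"
      unfolding W_def by (intro sum_mono norm_sum_add_char_interval_le) auto
    also have "\<dots> = 2 * real n * ((\<Sum>k\<in>{1..<n}. 1 / real k) + (\<Sum>k\<in>{1..<n}. 1 / real (n - k)))"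
      unfolding sum_distrib_left[symmetric] sum.distrib ..
    also have "(\<Sum>k\<in>{1..<n}. 1 / real (n - k)) = (\<Sum>k\<in>{1..<n}. 1 / real k)"
      by (rule sum.reindex_bij_witness[of _ "\<lambda>k. n - k" "\<lambda>k. n - k"]) auto
    also have "2 * real n * ((\<Sum>k\<in>{1..<n}. 1 / real k) + (\<Sum>k\<in>{1..<n}. 1 / real k)) \<le> 2 * real n * (harm n + harm n)"
      using h by (intro mult_left_mono add_mono) auto
    finally show ?thesis by (simp add: distrib_left)
  qed
  then have "B * (\<Sum>k<n. norm (W k)) \<le> B * (real n * (1 + 4 * harm n))"
    using B0 by (rule mult_left_mono)
  with * have "real n * norm (\<Sum>j\<in>{1..K}. f j) \<le> real n * (B * (1 + 4 * harm n))"
    by (simp only: mult.left_commute order_trans)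
  then show ?thesis using n by (simp only: mult_le_cancel_left_pos of_nat_0_less_iff)
qed

section \<open>Gauss sums and points in boxes\<close>

text \<open>The norm of G is the same at all \<tau> points of the coset {c h^j}. These are distinct
  residues, so \<tau> |G c|^2 is at most the second moment of G over all residues modulo p, which
  orthogonality evaluates as p \<tau>.\<close>

lemma gauss_sum_bound:
  fixes c h :: int
  assumes p: "prime p" and h: "coprime h (int p)" and c: "coprime c (int p)"
  defines "\<tau> \<equiv> ord (int p) h"
  shows "norm (\<Sum>u\<in>{1..\<tau>}. add_char p (c * h ^ u) * add_char \<tau> (k * int u)) \<le> sqrt (real p)"
proof -
  define G where "G c = (\<Sum>u\<in>{1..\<tau>}. add_char p (c * h ^ u) * add_char \<tau> (k * int u))" for c
  have p0: "p > 0" using p prime_gt_0_nat by blast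
  have t0: "\<tau> > 0" unfolding \<tau>_def by (rule ord_int_bounds[OF h p])
  have pow: "[h ^ i = h ^ j] (mod int p) \<longleftrightarrow> [i = j] (mod \<tau>)" for i j
    unfolding \<tau>_def by (rule ord_int_power_cong_iff[OF h p0])
  have inj: "u = w" if "u \<in> {1..\<tau>}" "w \<in> {1..\<tau>}" "[h ^ u = h ^ w] (mod int p)" for u w
  proof -
    have "[u - 1 = w - 1] (mod \<tau>)"
      using that pow[of u w] cong_add_rcancel_nat[of "u - 1" 1 "w - 1" \<tau>] by simp
    then show ?thesis using that by (auto simp: cong_def)
  qed
  have G_cong: "G c1 = G c2" if "[c1 = c2] (mod int p)" for c1 c2
    unfolding G_def using that
    by (intro sum.cong arg_cong2[of _ _ _ _ "(*)"] add_char_cong cong_mult) auto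
  \<comment> \<open>Both h^u modulo p and the twist e(ku/\<tau>) have period \<tau> in u. Replacing
    c by c h therefore rotates the range of summation and pulls out a unimodular factor.\<close>
  have shift: "norm (G (c * h)) = norm (G c)" for c
  proof -
    define F where "F u = add_char p (c * h ^ u) * add_char \<tau> (k * int u)" for u
    have F: "F (Suc \<tau>) = F 1"
    proof -
      have "[h ^ Suc \<tau> = h ^ 1] (mod int p)" 
        unfolding pow using mod_add_self2[of 1 \<tau>] by (simp add: cong_def)
      then have "[c * h ^ Suc \<tau> = c * h ^ 1] (mod int p)" by (intro cong_mult cong_refl)
      moreover have "[k * int (Suc \<tau>) = k * int 1] (mod int \<tau>)"
        by (simp add: cong_def algebra_simps)
      ultimately show ?thesis unfolding F_def by (simp only: add_char_cong)
    qed
    have "G (c * h) = (\<Sum>u\<in>{1..\<tau>}. add_char \<tau> (- k) * F (Suc u))"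
      unfolding G_def F_def
    proof (intro sum.cong refl)
      fix u
      have "add_char \<tau> (k * int u) = add_char \<tau> (- k) * add_char \<tau> (k * int (Suc u))"
        by (simp add: add_char_add[symmetric] algebra_simps)
      moreover have "c * h * h ^ u = c * h ^ Suc u" by simp
      ultimately show "add_char p (c * h * h ^ u) * add_char \<tau> (k * int u) =
          add_char \<tau> (- k) * (add_char p (c * h ^ Suc u) * add_char \<tau> (k * int (Suc u)))"
        by (simp only: mult_ac)
    qed
    also have "\<dots> = add_char \<tau> (- k) * (\<Sum>u\<in>{1..\<tau>}. F (Suc u))"
      by (simp add: sum_distrib_left)
    also have "(\<Sum>u\<in>{1..\<tau>}. F (Suc u)) = sum F {Suc 1..Suc \<tau>}"
      by (rule sum.shift_bounds_cl_Suc_ivl[symmetric])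
    also have "\<dots> = sum F {1..\<tau>}"
      using t0 sum.atLeast_Suc_atMost[of 1 "Suc \<tau>" F] sum.atLeast_Suc_atMost[of 1 \<tau> F] F
      by (simp add: sum.cl_ivl_Suc)
    also have "\<dots> = G c" by (simp add: G_def F_def)
    finally show ?thesis by (simp add: norm_mult)
  qed
  have shifts: "norm (G (c * h ^ j)) = norm (G c)" for j
  proof (induction j)
    case (Suc j)
    have "c * h ^ Suc j = c * h ^ j * h" by simp
    then show ?case using shift[of "c * h ^ j"] Suc by (simp only:)
  qed simp
  have "real \<tau> * norm (G c) ^ 2 = (\<Sum>j\<in>{1..\<tau>}. norm (G (c * h ^ j)) ^ 2)"
    by (simp add: shifts)
  also have "\<dots> = (\<Sum>j\<in>{1..\<tau>}. norm (G (int (nat (c * h ^ j mod int p)))) ^ 2)"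
    using p0 by (intro sum.cong refl arg_cong[of _ _ "\<lambda>x. norm x ^ 2"] G_cong) simp
  also have "\<dots> = (\<Sum>c'\<in>(\<lambda>j. nat (c * h ^ j mod int p)) ` {1..\<tau>}. norm (G (int c')) ^ 2)"
  proof (subst sum.reindex)
    show "inj_on (\<lambda>j. nat (c * h ^ j mod int p)) {1..\<tau>}"
    proof (rule inj_onI)
      fix i j assume ij: "i \<in> {1..\<tau>}" "j \<in> {1..\<tau>}"
        and "nat (c * h ^ i mod int p) = nat (c * h ^ j mod int p)"
      then have "[c * h ^ i = c * h ^ j] (mod int p)" using p0 by (simp add: cong_def nat_eq_iff)
      then have "[h ^ i = h ^ j] (mod int p)" using cong_mult_lcancel[OF c] by blast
      then show "i = j" using inj ij by blast
    qed
  qed simp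
  \<comment> \<open>All terms are nonnegative, so the coset may be enlarged to the full set of
    residues.\<close>
  also have "\<dots> \<le> (\<Sum>c'<p. norm (G (int c')) ^ 2)"
    using p0 by (intro sum_mono2) (auto simp: nat_less_iff)
  also have "\<dots> = real p * real \<tau>"
  proof -
    have "complex_of_real (\<Sum>c'<p. norm (G (int c')) ^ 2) = (\<Sum>c'<p. G (int c') * cnj (G (int c')))"
      unfolding of_real_sum by (intro sum.cong refl complex_norm_square)
    also have "\<dots> = (\<Sum>c'<p. \<Sum>u\<in>{1..\<tau>}. \<Sum>w\<in>{1..\<tau>}.
        add_char \<tau> (k * int u - k * int w) * add_char p ((h ^ u - h ^ w) * int c'))"
      unfolding G_def cnj_sum sum_product
    proof (intro sum.cong refl)
      fix c' u w
      have "add_char \<tau> (k * int u - k * int w) = add_char \<tau> (k * int u) * add_char \<tau> (- (k * int w))"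
        by (simp add: add_char_add[symmetric])
      moreover have "add_char p ((h ^ u - h ^ w) * int c') = add_char p (int c' * h ^ u) * add_char p (- (int c' * h ^ w))"
        by (simp add: add_char_add[symmetric] algebra_simps)
      ultimately show "add_char p (int c' * h ^ u) * add_char \<tau> (k * int u) *
          cnj (add_char p (int c' * h ^ w) * add_char \<tau> (k * int w)) =
          add_char \<tau> (k * int u - k * int w) * add_char p ((h ^ u - h ^ w) * int c')"
        by (simp only: complex_cnj_mult cnj_add_char mult_ac)
    qed
    also have "\<dots> = (\<Sum>u\<in>{1..\<tau>}. \<Sum>w\<in>{1..\<tau>}. \<Sum>c'<p.
        add_char \<tau> (k * int u - k * int w) * add_char p ((h ^ u - h ^ w) * int c'))"
      by (subst sum.swap, rule sum.cong[OF refl], rule sum.swap)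
    also have "\<dots> = (\<Sum>u\<in>{1..\<tau>}. \<Sum>w\<in>{1..\<tau>}. if w = u then of_nat p else 0)"
    proof (intro sum.cong refl)
      fix u w assume uw: "u \<in> {1..\<tau>}" "w \<in> {1..\<tau>}"
      have "int p dvd h ^ u - h ^ w \<longleftrightarrow> w = u"
        using inj[OF uw] by (auto simp: cong_iff_dvd_diff)
      then show "(\<Sum>c'<p. add_char \<tau> (k * int u - k * int w) * add_char p ((h ^ u - h ^ w) * int c'))
          = (if w = u then of_nat p else 0)"
        unfolding sum_distrib_left[symmetric] sum_add_char_residues[OF p0] by simp
    qed
    also have "\<dots> = of_real (real p * real \<tau>)" by simp
    finally show ?thesis by (simp only: of_real_eq_iff)
  qed
  finally have "real \<tau> * norm (G c) ^ 2 \<le> real \<tau> * real p"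
    by (simp only: mult.commute)
  then have "norm (G c) ^ 2 \<le> real p" using t0 by simp
  then have "norm (G c) \<le> sqrt (real p)" by (rule real_le_rsqrt)
  then show ?thesis unfolding G_def .
qed

lemma exp_sum_bound:
  fixes c h :: int
  assumes p: "prime p" and h: "coprime h (int p)" and c: "coprime c (int p)"
    and K: "K \<le> ord (int p) h"
  shows "norm (\<Sum>u\<in>{1..K}. add_char p (c * h ^ u)) \<le> sqrt (real p) * (1 + 4 * harm p)"
proof -
  have "norm (\<Sum>u\<in>{1..K}. add_char p (c * h ^ u)) \<le> sqrt (real p) * (1 + 4 * harm (ord (int p) h))"
    by (rule completion_bound[OF ord_int_bounds(1)[OF h p] K gauss_sum_bound[OF p h c]])
  also have "\<dots> \<le> sqrt (real p) * (1 + 4 * harm p)"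
    using harm_mono[of "ord (int p) h" p, where 'a = real] ord_int_bounds(2)[OF h p]
    by (intro mult_left_mono) auto
  finally show ?thesis .
qed

lemma card_residue_class_period:
  fixes z :: int
  assumes "p > 0"
  shows "card {v\<in>{1..p}. [int v = z] (mod int p)} = 1"
proof -
  \<comment> \<open>The window is {1..p} rather than {0..p-1}, hence the shift by one before and
    after reduction.\<close>
  define v0 where "v0 = nat ((z - 1) mod int p) + 1"
  have v0: "int v0 = (z - 1) mod int p + 1" using assms by (simp add: v0_def)
  have "[int v0 = z] (mod int p)" unfolding v0 by (simp add: cong_def mod_simps)
  moreover have "v0 \<in> {1..p}"
  proof -
    have "(z - 1) mod int p < int p" using assms by simp
    then have "int v0 \<le> int p" using v0 by linarith
    then have "v0 \<le> p" by linarith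
    moreover have "1 \<le> v0" by (simp add: v0_def)
    ultimately show ?thesis by simp
  qed
  moreover have "v = v0" if "v \<in> {1..p}" "[int v = z] (mod int p)" for v
  proof -
    have "[int v - 1 = z - 1] (mod int p)" using that(2) by (intro cong_diff cong_refl)
    then have "(int v - 1) mod int p = (z - 1) mod int p" by (simp add: cong_def)
    moreover have "(int v - 1) mod int p = int v - 1"
      using that(1) by (intro mod_pos_pos_trivial) auto
    ultimately show ?thesis using v0 by linarith
  qed
  ultimately have "{v\<in>{1..p}. [int v = z] (mod int p)} = {v0}" by blast
  then show ?thesis by simp
qed

text \<open>Completion in v leaves, at each frequency not divisible by p, a sum of e(k b h^u / p)
  over u <= K, which \<open>exp_sum_bound\<close> has already completed in u. Each completion costs
  one factor 1 + 4 harm p.\<close>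

lemma card_exp_curve_box:
  fixes b h :: int
  assumes p: "prime p" and h: "coprime h (int p)" and b: "coprime b (int p)"
    and K: "K \<le> ord (int p) h" and L: "L \<le> p"
  shows "\<bar>real (card {(u, v). u \<in> {1..K} \<and> v \<in> {1..L} \<and> [int v = b * h ^ u] (mod int p)})
            - real K * real L / real p\<bar> \<le> sqrt (real p) * (1 + 4 * harm p) ^ 2"
proof -
  have p0: "p > 0" using p prime_gt_0_nat by blast
  \<comment> \<open>Subtracting the mean K/p makes the frequencies divisible by p contribute exactly
    0.\<close>
  define f :: "nat \<Rightarrow> complex" where
    "f v = (\<Sum>u\<in>{1..K}. if [int v = b * h ^ u] (mod int p) then 1 else 0) - of_nat K / of_nat p" for v
  have "norm (\<Sum>v\<in>{1..L}. f v) \<le> sqrt (real p) * (1 + 4 * harm p) * (1 + 4 * harm p)"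
  proof (rule completion_bound[OF p0 L])
    fix k
    have "(\<Sum>v\<in>{1..p}. f v * add_char p (int k * int v)) =
       (\<Sum>v\<in>{1..p}. \<Sum>u\<in>{1..K}. if [int v = b * h ^ u] (mod int p) then add_char p (int k * int v) else 0)
       - of_nat K / of_nat p * (\<Sum>v\<in>{1..p}. add_char p (int k * int v))"
      unfolding f_def left_diff_distrib sum_subtractf sum_distrib_right sum_distrib_left
      by (simp add: if_distrib if_distribR cong: if_cong)
    also have "(\<Sum>v\<in>{1..p}. \<Sum>u\<in>{1..K}. if [int v = b * h ^ u] (mod int p) then add_char p (int k * int v) else 0)
       = (\<Sum>u\<in>{1..K}. \<Sum>v\<in>{1..p}. if [int v = b * h ^ u] (mod int p) then add_char p (int k * int v) else 0)"
      by (rule sum.swap)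
    also have "\<dots> = (\<Sum>u\<in>{1..K}. add_char p (int k * b * h ^ u))"
    proof (intro sum.cong refl)
      fix u
      have "(\<Sum>v\<in>{1..p}. if [int v = b * h ^ u] (mod int p) then add_char p (int k * int v) else 0)
         = (\<Sum>v\<in>{v\<in>{1..p}. [int v = b * h ^ u] (mod int p)}. add_char p (int k * int v))"
        by (rule sum.inter_filter[symmetric]) simp
      also have "\<dots> = (\<Sum>v\<in>{v\<in>{1..p}. [int v = b * h ^ u] (mod int p)}. add_char p (int k * b * h ^ u))"
        unfolding mult.assoc by (intro sum.cong refl add_char_cong cong_mult) auto
      also have "\<dots> = add_char p (int k * b * h ^ u)"
        unfolding sum_constant card_residue_class_period[OF p0] by simp
      finally show "(\<Sum>v\<in>{1..p}. if [int v = b * h ^ u] (mod int p) then add_char p (int k * int v) else 0)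
         = add_char p (int k * b * h ^ u)" .
    qed
    finally have eq: "(\<Sum>v\<in>{1..p}. f v * add_char p (int k * int v)) =
       (\<Sum>u\<in>{1..K}. add_char p (int k * b * h ^ u)) -
       of_nat K / of_nat p * (if int p dvd int k then of_nat p else 0)"
      unfolding sum_add_char[OF p0] .
    show "norm (\<Sum>v\<in>{1..p}. f v * add_char p (int k * int v)) \<le> sqrt (real p) * (1 + 4 * harm p)"
    proof (cases "int p dvd int k")
      case True
      then have "add_char p (int k * b * h ^ u) = 1" for u
        using add_char_eq_1_iff[OF p0] by (metis dvd_mult2)
      then have "(\<Sum>v\<in>{1..p}. f v * add_char p (int k * int v)) = 0"
        unfolding eq using True p0 by simp
      then show ?thesis using harm_nonneg[of p, where 'a = real] by simp
    next
      case False
      then have "coprime (int k) (int p)"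
        using p by (metis coprime_commute prime_imp_coprime prime_nat_int_transfer)
      then have "coprime (int k * b) (int p)" using b by simp
      then show ?thesis unfolding eq using exp_sum_bound[OF p h _ K, of "int k * b"] False by simp
    qed
  qed
  moreover have "(\<Sum>v\<in>{1..L}. f v) = of_real (real (card {(u, v). u \<in> {1..K} \<and> v \<in> {1..L} \<and> [int v = b * h ^ u] (mod int p)})
            - real K * real L / real p)"
  proof -
    have "{(u, v). u \<in> {1..K} \<and> v \<in> {1..L} \<and> [int v = b * h ^ u] (mod int p)}
        = {z\<in>{1..K} \<times> {1..L}. [int (snd z) = b * h ^ fst z] (mod int p)}" by auto
    then have "of_nat (card {(u, v). u \<in> {1..K} \<and> v \<in> {1..L} \<and> [int v = b * h ^ u] (mod int p)})
        = (\<Sum>z\<in>{1..K} \<times> {1..L}. if [int (snd z) = b * h ^ fst z] (mod int p) then 1 else (0::complex))"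
      by (simp add: sum.If_cases Int_def)
    also have "\<dots> = (\<Sum>u\<in>{1..K}. \<Sum>v\<in>{1..L}. if [int v = b * h ^ u] (mod int p) then 1 else 0)"
      by (simp add: sum.cartesian_product case_prod_unfold)
    also have "\<dots> = (\<Sum>v\<in>{1..L}. \<Sum>u\<in>{1..K}. if [int v = b * h ^ u] (mod int p) then 1 else 0)"
      by (rule sum.swap)
    finally show ?thesis unfolding f_def sum_subtractf by (simp add: mult.commute)
  qed
  ultimately show ?thesis by (simp only: norm_of_real power2_eq_square mult.assoc)
qed

section \<open>The divisor bound and the Moebius function\<close>

text \<open>Every divisor has the form q^i e with i <= k and e dividing m.\<close>

lemma card_divisors_prime_power_mult_le:
  fixes q m :: nat
  assumes "prime q" "m > 0"
  shows "card {d. d dvd q ^ k * m} \<le> (k + 1) * card {d. d dvd m}"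
proof -
  have fin: "finite ({..k} \<times> {d. d dvd m})"
    using assms by (intro finite_cartesian_product) auto
  have "{d. d dvd q ^ k * m} \<subseteq> (\<lambda>(i, e). q ^ i * e) ` ({..k} \<times> {d. d dvd m})"
  proof
    fix d assume "d \<in> {d. d dvd q ^ k * m}"
    then obtain b c where bc: "d = b * c" "b dvd q ^ k" "c dvd m"
      using division_decomp[of d "q ^ k" m] by auto
    obtain i where "i \<le> k" "b = q ^ i"
      using bc(2) divides_primepow_nat[OF assms(1)] by blast
    then show "d \<in> (\<lambda>(i, e). q ^ i * e) ` ({..k} \<times> {d. d dvd m})"
      using bc by auto
  qed
  then have "card {d. d dvd q ^ k * m} \<le> card ((\<lambda>(i, e). q ^ i * e) ` ({..k} \<times> {d. d dvd m}))"
    using fin by (intro card_mono) auto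
  also have "\<dots> \<le> card ({..k} \<times> {d. d dvd m})" by (rule card_image_le[OF fin])
  also have "\<dots> = (k + 1) * card {d. d dvd m}" by (simp add: card_cartesian_product)
  finally show ?thesis .
qed

text \<open>The ratio of the divisor count to n^\<epsilon> is controlled prime by prime: the factor
  (k + 1) / q^(k \<epsilon>) is at most 1 once q >= Q and at most W for the finitely many smaller
  primes.\<close>

lemma divisor_bound:
  fixes \<epsilon> :: real
  assumes e: "\<epsilon> > 0"
  obtains C where "C \<ge> 1" "\<And>n::nat. n > 0 \<Longrightarrow> real (card {d. d dvd n}) \<le> C * real n powr \<epsilon>"
proof -
  define a where "a = \<epsilon> * ln 2"
  have a: "a > 0" using e by (simp add: a_def)
  define W where "W = 1 + 1 / a"
  have W1: "W \<ge> 1" using a by (simp add: W_def)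
  \<comment> \<open>This is 1 + x <= exp x at x = k \<epsilon> ln 2; the constant 1 + 1/a turns 1 +
    k a into something at least k + 1.\<close>
  have W: "real k + 1 \<le> W * 2 powr (real k * \<epsilon>)" for k
  proof -
    have "1 + real k * a \<le> exp (real k * a)" by (rule exp_ge_add_one_self)
    also have "\<dots> = 2 powr (real k * \<epsilon>)" by (simp add: powr_def a_def mult.assoc)
    finally have "W * (1 + real k * a) \<le> W * 2 powr (real k * \<epsilon>)"
      using W1 by (intro mult_left_mono) auto
    moreover have "W * (1 + real k * a) = 1 + real k + real k * a + 1 / a"
      using a by (simp add: W_def field_simps)
    moreover have "0 \<le> real k * a" "0 \<le> 1 / a" using a by auto
    ultimately show ?thesis by linarith
  qed
  \<comment> \<open>The threshold satisfies Q^\<epsilon> = 2, so q >= Q gives q^(k \<epsilon>) >=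
    2^k >= k + 1.\<close>
  define Q :: real where "Q = 2 powr (1 / \<epsilon>)"
  define w where "w q = (if real q < Q then W else 1)" for q :: nat
  have w1: "w q \<ge> 1" for q using W1 by (simp add: w_def)
  have w: "real k + 1 \<le> w q * (real q ^ k) powr \<epsilon>" if "prime q" for q k :: nat
  proof -
    have q2: "real q \<ge> 2" using prime_ge_2_nat[OF that] by simp
    have pw: "(real q ^ k) powr \<epsilon> = real q powr (real k * \<epsilon>)"
      using q2 by (simp add: powr_realpow[symmetric] powr_powr)
    show ?thesis
    proof (cases "real q < Q")
      case True
      have "2 powr (real k * \<epsilon>) \<le> real q powr (real k * \<epsilon>)"
        using q2 e by (intro powr_mono2) auto
      then have "W * 2 powr (real k * \<epsilon>) \<le> W * real q powr (real k * \<epsilon>)"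
        using W1 by (intro mult_left_mono) auto
      then show ?thesis using W[of k] True by (simp add: w_def pw)
    next
      case False
      have "real k + 1 \<le> 2 ^ k"
      proof (induction k)
        case (Suc k)
        have "(1::real) \<le> 2 ^ k" by simp
        then show ?case using Suc by simp
      qed simp
      also have "\<dots> = 2 powr real k" by (simp add: powr_realpow)
      also have "\<dots> = Q powr (real k * \<epsilon>)" using e by (simp add: Q_def powr_powr)
      also have "\<dots> \<le> real q powr (real k * \<epsilon>)"
        using False e by (intro powr_mono2) (auto simp: Q_def)
      finally show ?thesis using False by (simp add: w_def pw)
    qed
  qed
  define N where "N = nat \<lceil>Q\<rceil>"
  \<comment> \<open>Strong induction, splitting off the full power of one prime at each step so that
    the set of prime factors loses exactly that prime.\<close>
  have main: "real (card {d. d dvd n}) \<le> (\<Prod>q\<in>prime_factors n. w q) * real n powr \<epsilon>" if "n > 0" for n :: nat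
    using that
  proof (induction n rule: less_induct)
    case (less n)
    show ?case
    proof (cases "n = 1")
      case False
      then obtain q where q: "prime q" "q dvd n" using prime_factor_nat by blast
      obtain m where "n = q ^ multiplicity q n * m" "\<not> q dvd m"
        using multiplicity_decompose'[of n q] q(1) less.prems by (metis not_prime_unit less_irrefl)
      then obtain k where km: "n = q ^ k * m" "\<not> q dvd m" by blast
      have m0: "m > 0" using km less.prems by (cases m) auto
      have k0: "k > 0" using km q by (cases k) auto
      have "q ^ k > 1" by (rule one_less_power[OF prime_gt_1_nat[OF q(1)] k0])
      then have mn: "m < n" using m0 by (simp add: km(1))
      have pf: "prime_factors n = insert q (prime_factors m)"
        using q k0 m0 by (simp add: km(1) prime_factors_product prime_factorization_prime_power)
      have qm: "q \<notin> prime_factors m" using km(2) by (auto simp: in_prime_factors_iff)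
      have "real (card {d. d dvd n}) \<le> real ((k + 1) * card {d. d dvd m})"
        using card_divisors_prime_power_mult_le[OF q(1) m0, of k] km(1) by (simp only: of_nat_le_iff)
      also have "\<dots> = (real k + 1) * real (card {d. d dvd m})" by (simp add: distrib_right)
      also have "\<dots> \<le> (w q * (real q ^ k) powr \<epsilon>) * ((\<Prod>q\<in>prime_factors m. w q) * real m powr \<epsilon>)"
        using w[OF q(1), of k] less.IH[OF mn m0] w1[of q] by (intro mult_mono) auto
      also have "\<dots> = (\<Prod>q\<in>prime_factors n. w q) * real n powr \<epsilon>"
        unfolding pf using qm by (simp add: km(1) powr_mult)
      finally show ?thesis .
    qed simp
  qed
  have "(\<Prod>q\<in>prime_factors n. w q) \<le> W ^ N" for n :: nat
  proof -
    have "(\<Prod>q\<in>prime_factors n. w q) = (\<Prod>q\<in>{q\<in>prime_factors n. real q < Q}. W)"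
      unfolding w_def by (rule prod.inter_filter[symmetric]) simp
    also have "\<dots> = W ^ card {q\<in>prime_factors n. real q < Q}" by simp
    also have "\<dots> \<le> W ^ N"
    proof (rule power_increasing[OF _ W1])
      have "{q\<in>prime_factors n. real q < Q} \<subseteq> {..<N}"
        by (auto simp: N_def) linarith
      then have "card {q\<in>prime_factors n. real q < Q} \<le> card {..<N}"
        by (intro card_mono) auto
      then show "card {q\<in>prime_factors n. real q < Q} \<le> N" by simp
    qed
    finally show ?thesis .
  qed
  then have "real (card {d. d dvd n}) \<le> W ^ N * real n powr \<epsilon>" if "n > 0" for n :: nat
    using main[OF that] by (meson mult_right_mono order_trans powr_ge_zero)
  moreover have "W ^ N \<ge> 1" using W1 by simp
  ultimately show thesis using that by blast
qed

text \<open>The sequence harm n - ln n decreases from 1, and ln x <= x - 1 at x = n^\<epsilon>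
  bounds the logarithm by n^\<epsilon> / \<epsilon>.\<close>

lemma harm_le_powr:
  fixes \<epsilon> :: real
  assumes e: "\<epsilon> > 0" and n: "n > 0"
  shows "1 + 4 * harm n \<le> (5 + 4 / \<epsilon>) * real n powr \<epsilon>"
proof -
  have "harm (Suc (n - 1)) - ln (real (Suc (n - 1))) \<le> harm (Suc 0) - ln (real (Suc 0))"
    using decseqD[OF decseq_harm_diff_ln, of 0 "n - 1"] by simp
  then have h: "harm n \<le> 1 + ln (real n)" using n by (simp add: harm_expand)
  have "ln (real n powr \<epsilon>) \<le> real n powr \<epsilon> - 1"
    using n by (intro ln_le_minus_one) auto
  then have "\<epsilon> * ln (real n) \<le> real n powr \<epsilon>" using n by (simp add: ln_powr)
  then have l: "ln (real n) \<le> real n powr \<epsilon> / \<epsilon>"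
    using e by (simp add: field_simps)
  have "1 \<le> real n powr \<epsilon>" using n e by (intro ge_one_powr_ge_zero) auto
  then have "1 + 4 * harm n \<le> 5 * real n powr \<epsilon> + 4 * (real n powr \<epsilon> / \<epsilon>)"
    using h l by linarith
  also have "\<dots> = (5 + 4 / \<epsilon>) * real n powr \<epsilon>" by (simp add: distrib_right)
  finally show ?thesis .
qed

section \<open>The Moebius function and the partial sums of mu(d)/d^2\<close>

definition moebius :: "nat \<Rightarrow> real" where
  "moebius n = (if squarefree n then (- 1) ^ card (prime_factors n) else 0)"

lemma abs_moebius_le_1: "\<bar>moebius n\<bar> \<le> 1"
  by (simp add: moebius_def power_abs)

lemma moebius_prime_mult:
  assumes "prime q" "d > 0"
  shows "moebius (q * d) = (if q dvd d then 0 else - moebius d)"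
proof (cases "q dvd d")
  case True
  then have "q ^ 2 dvd q * d" by (simp add: power2_eq_square)
  then have "\<not> squarefree (q * d)" using assms(1) by (auto simp: squarefree_def)
  then show ?thesis using True by (simp add: moebius_def)
next
  case False
  then have "coprime q d" using assms prime_imp_coprime by blast
  then have "squarefree (q * d) \<longleftrightarrow> squarefree d"
    using squarefree_prime[OF assms(1)] squarefree_mult_coprime squarefree_multD(2) by blast
  moreover have "prime_factors (q * d) = insert q (prime_factors d)"
    using assms by (simp add: prime_factors_product prime_prime_factors)
  moreover have "q \<notin> prime_factors d" using False by (auto simp: in_prime_factors_iff)
  ultimately show ?thesis using False by (simp add: moebius_def)
qed

text \<open>Fix a prime q dividing n. A divisor d not divisible by q cancels against q d, and the
  divisors divisible by q^2 contribute 0.\<close>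

lemma sum_moebius_divisors:
  assumes "n > 0"
  shows "(\<Sum>d | d dvd n. moebius d) = (if n = 1 then 1 else 0)"
proof (cases "n = 1")
  case True
  then show ?thesis by (simp add: moebius_def)
next
  case False
  then obtain q where q: "prime q" "q dvd n" using prime_factor_nat by blast
  then obtain m where m: "n = q * m" by (auto elim: dvdE)
  have m0: "m > 0" using m assms by (cases m) auto
  have fin: "finite {d. d dvd n}" "finite {d. d dvd m}" using assms m0 by auto
  have D0: "{d. d dvd n \<and> \<not> q dvd d} = {d. d dvd m \<and> \<not> q dvd d}"
  proof -
    have "d dvd n \<longleftrightarrow> d dvd m" if "\<not> q dvd d" for d
    proof -
      have "coprime d q" using q(1) that by (metis coprime_commute prime_imp_coprime)
      then show ?thesis unfolding m by (simp add: coprime_dvd_mult_right_iff)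
    qed
    then show ?thesis by blast
  qed
  have D1: "{d. d dvd n \<and> q dvd d} = (\<lambda>e. q * e) ` {e. e dvd m}"
    using q(1) by (auto simp: m elim!: dvdE[of q] simp: image_iff)
  have "(\<Sum>d | d dvd n. moebius d) = (\<Sum>d | d dvd n \<and> \<not> q dvd d. moebius d) + (\<Sum>d | d dvd n \<and> q dvd d. moebius d)"
    using fin by (subst sum.union_disjoint[symmetric]) (auto intro!: sum.cong)
  also have "(\<Sum>d | d dvd n \<and> q dvd d. moebius d) = (\<Sum>e | e dvd m. moebius (q * e))"
    unfolding D1 using q(1) by (subst sum.reindex) (auto simp: inj_on_def prime_gt_0_nat)
  also have "\<dots> = (\<Sum>e | e dvd m. if \<not> q dvd e then - moebius e else 0)"
    using m0 by (intro sum.cong refl) (auto simp: moebius_prime_mult[OF q(1)] dvd_pos_nat)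
  also have "\<dots> = (\<Sum>e\<in>{e\<in>{e. e dvd m}. \<not> q dvd e}. - moebius e)"
    using fin by (intro sum.inter_filter[symmetric])
  also have "\<dots> = - (\<Sum>d | d dvd n \<and> \<not> q dvd d. moebius d)"
    unfolding D0 by (simp add: sum_negf)
  finally show ?thesis using False by simp
qed

lemma zeta_2_tail:
  assumes "Y > 0"
  shows "(\<Sum>n\<in>{1..Y}. 1 / real n ^ 2) \<le> pi\<^sup>2 / 6"
    and "pi\<^sup>2 / 6 - (\<Sum>n\<in>{1..Y}. 1 / real n ^ 2) \<le> 1 / real Y"
proof -
  define S where "S N = (\<Sum>n\<in>{1..N}. 1 / real n ^ 2)" for N
  have S_Suc: "S (Suc N) = S N + 1 / real (Suc N) ^ 2" for N by (simp add: S_def)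
  have "S N = (\<Sum>n<N. 1 / (real n + 1) ^ 2)" for N
    by (induction N) (simp_all add: S_def add.commute)
  then have "S = (\<lambda>N. \<Sum>n<N. 1 / (real n + 1) ^ 2)" by blast
  moreover have "(\<lambda>N. \<Sum>n<N. 1 / (real n + 1) ^ 2) \<longlonglongrightarrow> pi\<^sup>2 / 6"
    using inverse_squares_sums unfolding sums_def by (simp add: add.commute)
  ultimately have lim: "S \<longlonglongrightarrow> pi\<^sup>2 / 6" by simp
  have "S Y \<le> S N" if "N \<ge> Y" for N unfolding S_def using that by (intro sum_mono2) auto
  then show "(\<Sum>n\<in>{1..Y}. 1 / real n ^ 2) \<le> pi\<^sup>2 / 6"
    using LIMSEQ_le_const[OF lim, of "S Y"] unfolding S_def by blast
  \<comment> \<open>Telescoping, from 1/(N+1)^2 <= 1/N - 1/(N+1).\<close>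
  have "S N \<le> S Y + 1 / real Y - 1 / real N" if "N \<ge> Y" for N
    using that
  proof (induction N rule: dec_induct)
    case (step N)
    have N0: "real N > 0" using step assms by simp
    then have "1 / (real N + 1) ^ 2 \<le> 1 / (real N * (real N + 1))"
      by (intro divide_left_mono) (auto simp: power2_eq_square)
    also have "\<dots> = 1 / real N - 1 / (real N + 1)" using N0 by (simp add: field_simps)
    finally show ?case using step.IH unfolding S_Suc by (simp add: add.commute)
  qed simp
  then have "S N \<le> S Y + 1 / real Y" if "N \<ge> Y" for N
    using that by (smt (verit) of_nat_0_le_iff zero_le_divide_1_iff)
  then have "pi\<^sup>2 / 6 \<le> S Y + 1 / real Y"
    using LIMSEQ_le_const2[OF lim, of "S Y + 1 / real Y"] by blast
  then show "pi\<^sup>2 / 6 - (\<Sum>n\<in>{1..Y}. 1 / real n ^ 2) \<le> 1 / real Y"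
    unfolding S_def by linarith
qed

text \<open>Grouping the pairs (d, n) by the product m = d n leaves the inner sum of mu(d) over d
  dividing m, which survives only for m = 1.\<close>

lemma moebius_zeta_2_convolution:
  assumes "X > 0"
  shows "(\<Sum>d\<in>{1..X}. moebius d / real d ^ 2 * (\<Sum>n\<in>{1..X div d}. 1 / real n ^ 2)) = 1"
proof -
  have "(\<Sum>d\<in>{1..X}. moebius d / real d ^ 2 * (\<Sum>n\<in>{1..X div d}. 1 / real n ^ 2))
      = (\<Sum>d\<in>{1..X}. \<Sum>n\<in>{1..X div d}. moebius d / real (d * n) ^ 2)"
    by (simp add: sum_distrib_left power_mult_distrib)
  also have "\<dots> = (\<Sum>(d, n)\<in>Sigma {1..X} (\<lambda>d. {1..X div d}). moebius d / real (d * n) ^ 2)"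
    by (rule sum.Sigma) auto
  also have "\<dots> = (\<Sum>(m, d)\<in>Sigma {1..X} (\<lambda>m. {d. d dvd m}). moebius d / real m ^ 2)"
  proof (rule sum.reindex_bij_witness[of _ "\<lambda>(m, d). (d, m div d)" "\<lambda>(d, n). (d * n, d)"])
    fix z assume "z \<in> Sigma {1..X} (\<lambda>d. {1..X div d})"
    then obtain d n where z: "z = (d, n)" "d \<ge> 1" "n \<ge> 1" "n \<le> X div d" by auto
    then have "d * n \<le> X"
      by (metis div_times_less_eq_dividend mult.commute mult_le_mono1 order_trans)
    then show "(case z of (d, n) \<Rightarrow> (d * n, d)) \<in> Sigma {1..X} (\<lambda>m. {d. d dvd m})"
      using z by (auto simp: Suc_le_eq)
  next
    fix z assume "z \<in> Sigma {1..X} (\<lambda>m. {d. d dvd m})"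
    then obtain m d where z: "z = (m, d)" "m \<ge> 1" "m \<le> X" "d dvd m" by auto
    then obtain n where n: "m = d * n" by (auto elim: dvdE)
    have "d \<ge> 1" "n \<ge> 1" using z n by (cases d; cases n; auto)+
    moreover have "d \<le> X"
      using n z \<open>n \<ge> 1\<close> by (metis dvd_imp_le less_le_trans zero_less_one order_trans)
    moreover have "n \<le> X div d"
      using n z \<open>d \<ge> 1\<close> by (simp add: less_eq_div_iff_mult_less_eq mult.commute)
    ultimately show "(case z of (m, d) \<Rightarrow> (d, m div d)) \<in> Sigma {1..X} (\<lambda>d. {1..X div d})"
      using z n by auto
  qed auto
  also have "\<dots> = (\<Sum>m\<in>{1..X}. \<Sum>d | d dvd m. moebius d / real m ^ 2)"
    by (rule sum.Sigma[symmetric]) auto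
  also have "\<dots> = (\<Sum>m\<in>{1..X}. (if m = 1 then 1 else 0) / real m ^ 2)"
    by (intro sum.cong refl) (simp add: sum_divide_distrib[symmetric] sum_moebius_divisors)
  also have "\<dots> = (\<Sum>m\<in>{1..X}. if m = 1 then 1 else 0)" by (intro sum.cong refl) auto
  also have "\<dots> = 1" using assms by simp
  finally show ?thesis .
qed

text \<open>Multiplying by \<zeta> = pi^2/6 and subtracting the finite convolution identity leaves
  only tails of the zeta series; division by \<zeta> >= 1 does not increase the error.\<close>

lemma sum_moebius_over_squares:
  assumes X: "X > 0"
  shows "\<bar>(\<Sum>d\<in>{1..X}. moebius d / real d ^ 2) - 6 / pi\<^sup>2\<bar> \<le> 2 * harm X / real X"
proof -
  define S where "S N = (\<Sum>n\<in>{1..N}. 1 / real n ^ 2)" for N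
  define \<zeta> :: real where "\<zeta> = pi\<^sup>2 / 6"
  define A where "A = (\<Sum>d\<in>{1..X}. moebius d / real d ^ 2)"
  have pi9: "pi\<^sup>2 \<ge> 9" using power_mono[of 3 pi 2] pi_gt3 by simp
  have z1: "\<zeta> \<ge> 1" using pi9 by (simp add: \<zeta>_def)
  have "A * \<zeta> - 1 = (\<Sum>d\<in>{1..X}. moebius d / real d ^ 2 * (\<zeta> - S (X div d)))"
    using moebius_zeta_2_convolution[OF X] unfolding A_def S_def
    by (simp add: right_diff_distrib sum_subtractf sum_distrib_right)
  then have "\<bar>A * \<zeta> - 1\<bar> \<le> (\<Sum>d\<in>{1..X}. \<bar>moebius d / real d ^ 2 * (\<zeta> - S (X div d))\<bar>)"
    by (simp only: sum_abs)
  also have "\<dots> \<le> (\<Sum>d\<in>{1..X}. 2 / real X * inverse (real d))"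
  proof (rule sum_mono)
    fix d assume d: "d \<in> {1..X}"
    \<comment> \<open>As q >= 1, X < (q + 1) d <= 2 q d, so the tail bound 1/q is at most 2 d /
      X.\<close>
    define q where "q = X div d"
    have q0: "q > 0" using d by (simp add: q_def div_greater_zero_iff)
    have "X = q * d + X mod d" by (simp add: q_def)
    moreover have "X mod d < d" using d by simp
    moreover have "d \<le> q * d" using q0 by simp
    ultimately have "X \<le> q * d + q * d" by linarith
    then have "X \<le> 2 * (d * q)" by (simp add: mult.commute)
    then have Xq: "real X \<le> 2 * (real d * real q)"
      by (metis of_nat_le_iff of_nat_mult of_nat_numeral)
    have s: "0 \<le> \<zeta> - S q" "\<zeta> - S q \<le> 1 / real q"
      using zeta_2_tail[OF q0] unfolding \<zeta>_def S_def by auto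
    have "\<bar>moebius d / real d ^ 2 * (\<zeta> - S q)\<bar> = \<bar>moebius d\<bar> * ((\<zeta> - S q) / real d ^ 2)"
      using s by (simp add: abs_mult)
    also have "\<dots> \<le> 1 * ((1 / real q) / real d ^ 2)"
      using s abs_moebius_le_1 by (intro mult_mono divide_right_mono) auto
    also have "\<dots> = 1 / (real d * real q) * (1 / real d)" by (simp add: power2_eq_square)
    also have "\<dots> \<le> 2 / real X * (1 / real d)"
      using Xq X d q0 by (intro mult_right_mono) (auto simp: field_simps)
    finally show "\<bar>moebius d / real d ^ 2 * (\<zeta> - S (X div d))\<bar> \<le> 2 / real X * inverse (real d)"
      unfolding q_def by (simp add: inverse_eq_divide)
  qed
  also have "\<dots> = 2 * harm X / real X" 
    unfolding harm_def sum_distrib_left[symmetric] by simp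
  finally have *: "\<bar>A * \<zeta> - 1\<bar> \<le> 2 * harm X / real X" .
  have "A - 6 / pi\<^sup>2 = (A * \<zeta> - 1) / \<zeta>"
    using z1 by (simp add: \<zeta>_def field_simps)
  then have "\<bar>A - 6 / pi\<^sup>2\<bar> = \<bar>A * \<zeta> - 1\<bar> / \<zeta>"
    using z1 by simp
  also have "\<dots> \<le> \<bar>A * \<zeta> - 1\<bar> / 1"
    using z1 by (intro divide_left_mono) auto
  finally show ?thesis using * unfolding A_def by simp
qed

section \<open>Products and differences of solutions\<close>

text \<open>On a single residue class, n is determined by \<open>n div p\<close>.\<close>

lemma card_le_of_pairwise_cong:
  fixes A :: "nat set"
  assumes A: "A \<subseteq> {1..N}" and "\<And>m n. m \<in> A \<Longrightarrow> n \<in> A \<Longrightarrow> [m = n] (mod p)"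
  shows "real (card A) \<le> real N / real p + 1"
proof -
  have "inj_on (\<lambda>n. n div p) A"
  proof (rule inj_onI)
    fix m n assume mn: "m \<in> A" "n \<in> A" "m div p = n div p"
    then have "m mod p = n mod p" using assms(2)[OF mn(1,2)] by (simp add: cong_def)
    with mn(3) show "m = n" by (metis div_mult_mod_eq)
  qed
  moreover have "(\<lambda>n. n div p) ` A \<subseteq> {..N div p}"
    using A by (auto intro!: div_le_mono)
  ultimately have "card A \<le> card {..N div p}" by (rule card_inj_on_le) simp
  then have "real (card A) \<le> real (N div p) + 1" by simp
  also have "real (N div p) \<le> real N / real p" by (rule of_nat_div_le_of_nat)
  finally show ?thesis by simp
qed

text \<open>The k-tuples of points are counted through the map to (sum of the u's, product of the
  v's): there are few possible images, and each has few preimages.\<close>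

lemma product_curve_bound:
  fixes P :: "(nat \<times> nat) set" and a g :: int and d k X Y p :: nat and T :: real
  assumes p: "prime p" and d: "coprime d p" and k: "k > 0"
    and P: "P \<subseteq> {1..X} \<times> {1..Y}"
    and curve: "\<And>u v. (u, v) \<in> P \<Longrightarrow> [int d * int v = a * g ^ (d * u)] (mod int p)"
    and inj: "inj_on snd P"
    and T0: "T \<ge> 0"
    and T: "\<And>n. 0 < n \<Longrightarrow> n \<le> Y ^ k \<Longrightarrow> real (card {e. e dvd n}) \<le> T"
  shows "real (card P) ^ k \<le> (real k * real X) * (real (Y ^ k) / real p + 1) * T ^ k"
proof -
  have p0: "p > 0" using p prime_gt_0_nat by blast
  have finP: "finite P" using P finite_subset by blast
  define F where "F = PiE {..<k} (\<lambda>_. P)"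
  have finF: "finite F" unfolding F_def using finP by (intro finite_PiE) auto
  have cardF: "card F = card P ^ k" unfolding F_def using finP by (simp add: card_PiE)
  define \<phi> :: "(nat \<Rightarrow> nat \<times> nat) \<Rightarrow> nat \<times> nat" where
    "\<phi> f = (\<Sum>i<k. fst (f i), \<Prod>i<k. snd (f i))" for f
  \<comment> \<open>For a given sum s, multiplying the k congruences confines the product of the v's
    to one residue class, because d is invertible modulo p.\<close>
  define R where "R s = {n\<in>{1..Y ^ k}. [int d ^ k * int n = a ^ k * g ^ (d * s)] (mod int p)}" for s
  have R: "real (card (R s)) \<le> real (Y ^ k) / real p + 1" for s
  proof (rule card_le_of_pairwise_cong)
    fix m n assume mn: "m \<in> R s" "n \<in> R s"
    then have "[int d ^ k * int m = int d ^ k * int n] (mod int p)"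
      unfolding R_def by (auto intro: cong_trans cong_sym)
    moreover have "coprime (int d ^ k) (int p)" using d by simp
    ultimately have "[int m = int n] (mod int p)" using cong_mult_lcancel by blast
    then show "[m = n] (mod p)" by (simp add: cong_int_iff)
  qed (auto simp: R_def)
  define Z where "Z = Sigma {1..k * X} R"
  have finR: "finite (R s)" for s by (simp add: R_def)
  have finZ: "finite Z" unfolding Z_def using finR by blast
  have "real (card Z) = (\<Sum>s\<in>{1..k * X}. real (card (R s)))"
    unfolding Z_def using finR by (simp add: card_SigmaI)
  also have "\<dots> \<le> (\<Sum>s\<in>{1..k * X}. real (Y ^ k) / real p + 1)"
    by (intro sum_mono R)
  also have "\<dots> = (real k * real X) * (real (Y ^ k) / real p + 1)" by simp
  finally have cardZ: "real (card Z) \<le> (real k * real X) * (real (Y ^ k) / real p + 1)" .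
  have FP: "f i \<in> P" if "f \<in> F" "i < k" for f i using that unfolding F_def by auto
  have FXY: "fst (f i) \<ge> 1" "fst (f i) \<le> X" "snd (f i) \<ge> 1" "snd (f i) \<le> Y" if "f \<in> F" "i < k" for f i
    using FP[OF that] P by (cases "f i"; force)+
  have img: "\<phi> f \<in> Z" if f: "f \<in> F" for f
  proof -
    have "(\<Sum>i<k. 1) \<le> (\<Sum>i<k. fst (f i))" using FXY[OF f] by (intro sum_mono) auto
    moreover have "(\<Sum>i<k. fst (f i)) \<le> (\<Sum>i<k. X)"
      using FXY[OF f] by (intro sum_mono) auto
    ultimately have s: "(\<Sum>i<k. fst (f i)) \<in> {1..k * X}" using k by simp
    have "(\<Prod>i<k. 1) \<le> (\<Prod>i<k. snd (f i))" using FXY[OF f] by (intro prod_mono) auto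
    moreover have "(\<Prod>i<k. snd (f i)) \<le> (\<Prod>i<k. Y)"
      using FXY[OF f] by (intro prod_mono) auto
    ultimately have n: "(\<Prod>i<k. snd (f i)) \<in> {1..Y ^ k}" by simp
    have "[(\<Prod>i<k. int d * int (snd (f i))) = (\<Prod>i<k. a * g ^ (d * fst (f i)))] (mod int p)"
      using FP[OF f] by (intro cong_prod curve) auto
    then have "[int d ^ k * int (\<Prod>i<k. snd (f i)) = a ^ k * g ^ (d * (\<Sum>i<k. fst (f i)))] (mod int p)"
      by (simp add: prod.distrib sum_distrib_left power_sum)
    with s n show ?thesis unfolding \<phi>_def Z_def R_def by auto
  qed
  \<comment> \<open>Each v divides the prescribed product n, leaving at most T choices per
    coordinate; injectivity of \<open>snd\<close> on P then recovers the whole point.\<close>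
  have fib: "real (card {f\<in>F. \<phi> f = z}) \<le> T ^ k" if "z \<in> Z" for z
  proof -
    obtain s n where z: "z = (s, n)" by (cases z)
    then have n: "0 < n" "n \<le> Y ^ k" using that unfolding Z_def R_def by auto
    define D where "D = {e. e dvd n}"
    have finD: "finite D" using n by (simp add: D_def)
    have "card {f\<in>F. \<phi> f = z} \<le> card (PiE {..<k} (\<lambda>_. D))"
    proof (rule card_inj_on_le)
      show "inj_on (\<lambda>f. restrict (\<lambda>i. snd (f i)) {..<k}) {f\<in>F. \<phi> f = z}"
      proof (rule inj_onI)
        fix f f' assume f: "f \<in> {f\<in>F. \<phi> f = z}" "f' \<in> {f\<in>F. \<phi> f = z}"
          and eq: "restrict (\<lambda>i. snd (f i)) {..<k} = restrict (\<lambda>i. snd (f' i)) {..<k}"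
        show "f = f'"
        proof (rule PiE_ext)
          show "f \<in> PiE {..<k} (\<lambda>_. P)" "f' \<in> PiE {..<k} (\<lambda>_. P)"
            using f by (auto simp: F_def)
          fix i assume i: "i \<in> {..<k}"
          then have "snd (f i) = snd (f' i)" using fun_cong[OF eq, of i] by simp
          then show "f i = f' i" using inj FP f i by (auto dest: inj_onD)
        qed
      qed
      show "(\<lambda>f. restrict (\<lambda>i. snd (f i)) {..<k}) ` {f\<in>F. \<phi> f = z} \<subseteq> PiE {..<k} (\<lambda>_. D)"
      proof (rule image_subsetI)
        fix f assume "f \<in> {f\<in>F. \<phi> f = z}"
        then have "n = (\<Prod>i<k. snd (f i))" using z by (simp add: \<phi>_def)
        then show "restrict (\<lambda>i. snd (f i)) {..<k} \<in> PiE {..<k} (\<lambda>_. D)"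
          unfolding restrict_PiE_iff D_def by (auto intro!: dvd_prodI)
      qed
      show "finite (PiE {..<k} (\<lambda>_. D))" using finD by (intro finite_PiE) auto
    qed
    also have "\<dots> = card D ^ k" by (simp add: card_PiE)
    finally have "real (card {f\<in>F. \<phi> f = z}) \<le> real (card D) ^ k"
      by (metis of_nat_le_iff of_nat_power)
    also have "\<dots> \<le> T ^ k" using T[OF n] unfolding D_def by (intro power_mono) auto
    finally show ?thesis .
  qed
  have "F = (\<Union>z\<in>Z. {f\<in>F. \<phi> f = z})" using img by blast
  then have "card F = card (\<Union>z\<in>Z. {f\<in>F. \<phi> f = z})" by (rule arg_cong)
  also have "\<dots> \<le> (\<Sum>z\<in>Z. card {f\<in>F. \<phi> f = z})"
    by (rule card_UN_le[OF finZ])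
  finally have "real (card F) \<le> real (\<Sum>z\<in>Z. card {f\<in>F. \<phi> f = z})"
    by (simp only: of_nat_le_iff)
  also have "\<dots> = (\<Sum>z\<in>Z. real (card {f\<in>F. \<phi> f = z}))" by (rule of_nat_sum)
  also have "\<dots> \<le> (\<Sum>z\<in>Z. T ^ k)" by (intro sum_mono fib)
  also have "\<dots> = real (card Z) * T ^ k" by simp
  also have "\<dots> \<le> (real k * real X) * (real (Y ^ k) / real p + 1) * T ^ k"
    using cardZ T0 by (intro mult_right_mono) auto
  finally show ?thesis using cardF by simp
qed

text \<open>If x - y = x' - y', then x + y' = y + x', and multiplying congruences gives x y' = y x'
  modulo p. The difference of the two sides factors as (x - y)(y' - y), and both factors are smaller
  than p in size, so a nonzero difference determines its pair.\<close>

lemma twisted_fixed_points_bound: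
  fixes S :: "nat set" and a g :: int and u v K p :: nat
  assumes p: "prime p" and v: "coprime v p" and S: "S \<subseteq> {1..K}" and K: "K < p"
    and curve: "\<And>d. d \<in> S \<Longrightarrow> [int d * int v = a * g ^ (d * u)] (mod int p)"
  shows "card S ^ 2 \<le> 3 * K"
proof -
  have finS: "finite S" using S finite_subset by blast
  define Q where "Q = {z\<in>S \<times> S. fst z \<noteq> snd z}"
  have "inj_on (\<lambda>z. int (fst z) - int (snd z)) Q"
  proof (rule inj_onI)
    fix z z' assume z: "z \<in> Q" "z' \<in> Q" and eq: "int (fst z) - int (snd z) = int (fst z') - int (snd z')"
    obtain x y x' y' where xy: "z = (x, y)" "z' = (x', y')" by (cases z; cases z')
    have mem: "x \<in> S" "y \<in> S" "x' \<in> S" "y' \<in> S" "x \<noteq> y"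
      using z xy by (auto simp: Q_def)
    have e: "x + y' = y + x'" using eq xy by simp
    have "[(int x * int v) * (int y' * int v) = (a * g ^ (x * u)) * (a * g ^ (y' * u))] (mod int p)"
      by (intro cong_mult curve mem)
    also have "(a * g ^ (x * u)) * (a * g ^ (y' * u)) = a ^ 2 * g ^ ((x + y') * u)"
      by (simp add: power2_eq_square power_add distrib_right)
    also have "\<dots> = (a * g ^ (y * u)) * (a * g ^ (x' * u))"
      unfolding e by (simp add: power2_eq_square power_add distrib_right)
    also have "[\<dots> = (int y * int v) * (int x' * int v)] (mod int p)"
      by (intro cong_sym[OF cong_mult] curve mem)
    finally have "[int v ^ 2 * (int x * int y') = int v ^ 2 * (int y * int x')] (mod int p)"
      by (simp add: power2_eq_square mult_ac)
    moreover have "coprime (int v ^ 2) (int p)" using v by simp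
    ultimately have "[int x * int y' = int y * int x'] (mod int p)" using cong_mult_lcancel by blast
    then have "int p dvd int x * int y' - int y * int x'" by (simp add: cong_iff_dvd_diff)
    also have "int x * int y' - int y * int x' = (int x - int y) * (int y' - int y)"
    proof -
      have x': "int x' = int x + int y' - int y" using e by linarith
      show ?thesis unfolding x' by (simp add: algebra_simps)
    qed
    finally have "int p dvd int x - int y \<or> int p dvd int y' - int y"
      using p by (simp add: prime_dvd_mult_iff)
    moreover have "\<bar>int x - int y\<bar> < int p" "\<bar>int y' - int y\<bar> < int p"
    proof -
      have "x \<in> {1..K}" "y \<in> {1..K}" "y' \<in> {1..K}" using mem S by blast+
      then show "\<bar>int x - int y\<bar> < int p" "\<bar>int y' - int y\<bar> < int p"
        using K by auto
    qed
    moreover have "i = 0" if "int p dvd i" "\<bar>i\<bar> < int p" for i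
      using dvd_imp_le_int[of i "int p"] that by force
    ultimately have "int x - int y = 0 \<or> int y' - int y = 0" by blast
    then have "y' = y" using mem(5) by simp
    then show "z = z'" using e xy by simp
  qed
  moreover have "(\<lambda>z. int (fst z) - int (snd z)) ` Q \<subseteq> {- int K..int K} - {0}"
    using S by (force simp: Q_def)
  ultimately have "card Q \<le> card ({- int K..int K} - {0})" by (rule card_inj_on_le) simp
  also have "\<dots> = 2 * K" by simp
  finally have Q: "card Q \<le> 2 * K" .
  \<comment> \<open>The 3 K consists of 2 K possible nonzero differences and at most K diagonal
    pairs.\<close>
  have "S \<times> S = Q \<union> (\<lambda>x. (x, x)) ` S" by (auto simp: Q_def)
  then have "card (S \<times> S) \<le> card Q + card ((\<lambda>x. (x, x)) ` S)"
    by (metis card_Un_le)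
  also have "card ((\<lambda>x. (x, x)) ` S) \<le> card S" by (rule card_image_le[OF finS])
  also have "card S \<le> K" using card_mono[OF _ S] by simp
  finally show ?thesis using Q by (simp add: card_cartesian_product power2_eq_square)
qed

section \<open>The points divisible by d\<close>

lemma coprime_prime_less:
  fixes p d :: nat
  assumes "prime p" "0 < d" "d < p"
  shows "coprime d p"
proof -
  have "\<not> p dvd d" using assms nat_dvd_not_less by blast
  then have "coprime p d" by (rule prime_imp_coprime[OF assms(1)])
  then show ?thesis by (simp only: coprime_commute)
qed

text \<open>The bound of U by the order makes the exponents in the box give distinct powers of g; as
  the order is below p, all coordinates and all relevant d are coprime to p.\<close>

locale exp_curve_box =
  fixes p :: nat and a g :: int and U V :: real
  assumes p: "prime p" and a: "coprime a (int p)" and g: "coprime g (int p)"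
    and U: "0 < U" "U \<le> real (ord (int p) g)" and V: "0 < V" "V \<le> real (ord (int p) g)"
begin

definition W :: nat where "W = nat \<lfloor>U\<rfloor>"
definition Z :: nat where "Z = nat \<lfloor>V\<rfloor>"

definition curve :: "(nat \<times> nat) set" where
  "curve = {(x, y). x \<in> {1..W} \<and> y \<in> {1..Z} \<and> [int y = a * g ^ x] (mod int p)}"

text \<open>Represents the points of \<open>curve\<close> with both coordinates divisible by d,
  recorded by their quotients u = x/d and v = y/d.\<close>

definition scaled_curve :: "nat \<Rightarrow> (nat \<times> nat) set" where
  "scaled_curve d = {(u, v). u \<in> {1..W div d} \<and> v \<in> {1..Z div d} \<and>
     [int d * int v = a * g ^ (d * u)] (mod int p)}"

lemma p_pos: "p > 0" using p prime_gt_0_nat by blast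

lemma W_le_ord: "W \<le> ord (int p) g" and Z_le_ord: "Z \<le> ord (int p) g"
  using U(2) V(2) unfolding W_def Z_def by linarith+

lemma W_less: "W < p" and Z_less: "Z < p"
  using W_le_ord Z_le_ord ord_int_bounds(2)[OF g p] by linarith+

lemma U_less: "U < real p" and V_less: "V < real p"
  using U V ord_int_bounds(2)[OF g p] by linarith+

lemma W_le: "real W \<le> U" and Z_le: "real Z \<le> V"
  using U V unfolding W_def Z_def by linarith+

lemma div_W_le: "real (W div d) \<le> U / real d" and div_Z_le: "real (Z div d) \<le> V / real d"
proof -
  have "real (W div d) \<le> real W / real d" "real (Z div d) \<le> real Z / real d"
    by (rule of_nat_div_le_of_nat)+
  moreover have "real W / real d \<le> U / real d" "real Z / real d \<le> V / real d"
    using W_le Z_le by (intro divide_right_mono; simp)+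
  ultimately show "real (W div d) \<le> U / real d" "real (Z div d) \<le> V / real d" by linarith+
qed

lemma less_Suc_div:
  assumes "d > 0"
  shows "U / real d < real (W div d) + 1" "V / real d < real (Z div d) + 1"
proof -
  have *: "x / real d < real (n div d) + 1" if "x < real n + 1" for x n
  proof -
    have "n < d * Suc (n div d)"
      unfolding mult_Suc_right using mod_less_divisor[OF assms, of n] mult_div_mod_eq[of d n] by linarith
    then have "n + 1 \<le> d * Suc (n div d)" by simp
    then have "real (n + 1) \<le> real (d * Suc (n div d))" by (simp only: of_nat_le_iff)
    then have "x < real d * (real (n div d) + 1)" using that by (simp add: algebra_simps)
    then show ?thesis using assms by (simp add: field_simps)
  qed
  show "U / real d < real (W div d) + 1" "V / real d < real (Z div d) + 1"
    using U V by (intro *; simp add: W_def Z_def; linarith)+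
qed

lemma finite_scaled_curve [simp]: "finite (scaled_curve d)"
  by (rule finite_subset[of _ "{1..W div d} \<times> {1..Z div d}"]) (auto simp: scaled_curve_def)

lemma finite_curve [simp]: "finite curve"
  by (rule finite_subset[of _ "{1..W} \<times> {1..Z}"]) (auto simp: curve_def)

lemma visible_count_eq: "visible_count a g p U V = card {(x, y) \<in> curve. coprime x y}"
proof -
  have "{(x, y) \<in> exp_curve_points a g p U V. gcd x y = 1} =
      map_prod int int ` {(x, y) \<in> curve. coprime x y}" (is "?A = ?B")
  proof
    show "?B \<subseteq> ?A"
    proof
      fix z assume "z \<in> ?B"
      then obtain x y where z: "z = (int x, int y)" and xy: "(x, y) \<in> curve" "coprime x y"
        by auto
      have "x \<in> {1..W}" "y \<in> {1..Z}" using xy by (auto simp: curve_def)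
      then have "1 \<le> real x" "real x \<le> U" "1 \<le> real y" "real y \<le> V"
        using W_le Z_le by auto
      then show "z \<in> ?A" using xy z by (auto simp: exp_curve_points_def curve_def)
    qed
    show "?A \<subseteq> ?B"
    proof
      fix z assume "z \<in> ?A"
      then obtain x y where z: "z = (x, y)" and xy: "1 \<le> real_of_int x" "real_of_int x \<le> U"
        "1 \<le> real_of_int y" "real_of_int y \<le> V" "[y = a * g ^ nat x] (mod int p)" "gcd x y = 1"
        by (auto simp: exp_curve_points_def)
      have "1 \<le> x" "x \<le> \<lfloor>U\<rfloor>" "1 \<le> y" "y \<le> \<lfloor>V\<rfloor>"
        using xy by (auto simp: le_floor_iff)
      moreover from this have "coprime (int (nat x)) (int (nat y))"
        using xy(6) by (simp add: coprime_iff_gcd_eq_1)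
      then have "coprime (nat x) (nat y)" by (simp only: coprime_int_iff)
      ultimately have "(nat x, nat y) \<in> {(x, y) \<in> curve. coprime x y}"
        using xy by (auto simp: curve_def W_def Z_def nat_le_iff)
      moreover have "z = map_prod int int (nat x, nat y)"
        using z \<open>1 \<le> x\<close> \<open>1 \<le> y\<close> by simp
      ultimately show "z \<in> ?B" by blast
    qed
  qed
  moreover have "inj_on (map_prod int int) A" for A by (auto simp: inj_on_def)
  ultimately show ?thesis unfolding visible_count_def by (simp add: card_image)
qed

lemma card_multiples_eq:
  assumes "d > 0"
  shows "card {(x, y) \<in> curve. d dvd x \<and> d dvd y} = card (scaled_curve d)"
proof -
  have "{(x, y) \<in> curve. d dvd x \<and> d dvd y} = (\<lambda>(u, v). (d * u, d * v)) ` scaled_curve d" (is "?A = ?B")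
  proof
    show "?B \<subseteq> ?A"
      using assms by (auto simp: curve_def scaled_curve_def less_eq_div_iff_mult_less_eq mult.commute)
    show "?A \<subseteq> ?B"
    proof
      fix z assume "z \<in> ?A"
      then obtain u v where "z = (d * u, d * v)" "(d * u, d * v) \<in> curve" by (auto elim!: dvdE)
      moreover from this have "(u, v) \<in> scaled_curve d"
        using assms by (auto simp: curve_def scaled_curve_def less_eq_div_iff_mult_less_eq mult.commute)
      ultimately show "z \<in> ?B" by force
    qed
  qed
  moreover have "inj_on (\<lambda>(u, v). (d * u, d * v)) (scaled_curve d)"
    using assms by (auto simp: inj_on_def)
  ultimately show ?thesis by (simp add: card_image)
qed

text \<open>Moebius inversion over the divisors of gcd(x, y); since x <= W, all of them lie in
  {1..W}.\<close>

lemma visible_count_moebius: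
  "real (visible_count a g p U V) = (\<Sum>d\<in>{1..W}. moebius d * real (card (scaled_curve d)))"
proof -
  have "real (visible_count a g p U V) = (\<Sum>z\<in>curve. if coprime (fst z) (snd z) then 1 else 0)"
    unfolding visible_count_eq by (simp add: sum.If_cases Int_def case_prod_unfold)
  also have "\<dots> = (\<Sum>z\<in>curve. \<Sum>d\<in>{1..W}. if d dvd fst z \<and> d dvd snd z then moebius d else 0)"
  proof (rule sum.cong[OF refl])
    fix z assume z: "z \<in> curve"
    obtain x y where xy: "z = (x, y)" by (cases z)
    have x: "x \<ge> 1" "x \<le> W" using z xy by (auto simp: curve_def)
    have "d \<in> {1..W}" if "d dvd x" for d
      using that x dvd_pos_nat[of x d] dvd_imp_le[of d x] by simp
    then have "{d\<in>{1..W}. d dvd x \<and> d dvd y} = {d. d dvd gcd x y}" by auto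
    moreover have "(\<Sum>d\<in>{1..W}. if d dvd x \<and> d dvd y then moebius d else 0) =
        (\<Sum>d\<in>{d\<in>{1..W}. d dvd x \<and> d dvd y}. moebius d)"
      by (rule sum.inter_filter[symmetric]) simp
    ultimately have "(\<Sum>d\<in>{1..W}. if d dvd x \<and> d dvd y then moebius d else 0) = (\<Sum>d | d dvd gcd x y. moebius d)"
      by (simp only:)
    also have "\<dots> = (if coprime x y then 1 else 0)"
    proof -
      have "gcd x y > 0" using x by simp
      from sum_moebius_divisors[OF this] show ?thesis by (simp only: coprime_iff_gcd_eq_1)
    qed
    finally show "(if coprime (fst z) (snd z) then 1 else 0) =
        (\<Sum>d\<in>{1..W}. if d dvd fst z \<and> d dvd snd z then moebius d else 0)" by (simp add: xy)
  qed
  also have "\<dots> = (\<Sum>d\<in>{1..W}. \<Sum>z\<in>curve. if d dvd fst z \<and> d dvd snd z then moebius d else 0)"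
    by (rule sum.swap)
  also have "\<dots> = (\<Sum>d\<in>{1..W}. moebius d * real (card (scaled_curve d)))"
  proof (rule sum.cong[OF refl])
    fix d assume "d \<in> {1..W}"
    then show "(\<Sum>z\<in>curve. if d dvd fst z \<and> d dvd snd z then moebius d else 0) =
        moebius d * real (card (scaled_curve d))"
      by (simp add: card_multiples_eq[symmetric] sum.If_cases Int_def case_prod_unfold)
  qed
  finally show ?thesis .
qed

lemma coprime_of_le_W: "d \<in> {1..W} \<Longrightarrow> coprime d p"
  using W_less by (intro coprime_prime_less[OF p]) auto

text \<open>Dividing the congruence by d turns it into v = b h^u with h = g^d, so the box count
  applies with the box cut down to (U/d) by (V/d).\<close>

lemma scaled_curve_asymp:
  assumes d: "d \<in> {1..W}"
  shows "\<bar>real (card (scaled_curve d)) - U * V / (real d ^ 2 * real p)\<bar>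
      \<le> sqrt (real p) * (1 + 4 * harm p) ^ 2 + 2"
proof -
  define K L where "K = W div d" and "L = Z div d"
  have d0: "d > 0" using d by simp
  have cd: "coprime (int d) (int p)" using coprime_of_le_W[OF d] by simp
  obtain b' where b': "[int d * b' = 1] (mod int p)" using cong_solve_coprime_int[OF cd] by blast
  define b where "b = b' * a"
  have db: "[int d * b = a] (mod int p)"
    using cong_mult[OF b' cong_refl[of a]] by (simp add: b_def mult.assoc)
  have "coprime (int d * b) (int p)" using cong_imp_coprime[OF cong_sym[OF db]] a by blast
  then have b: "coprime b (int p)" by simp
  define h where "h = g ^ d"
  have h: "coprime h (int p)" using g by (simp add: h_def)
  \<comment> \<open>The order of g divides d times the order of h. Hence the order of h is at least
    W div d, as completion in u requires.\<close>
  have "[h ^ ord (int p) h = h ^ 0] (mod int p)"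
    unfolding ord_int_power_cong_iff[OF h p_pos] by (simp add: cong_def)
  then have "[g ^ (d * ord (int p) h) = g ^ 0] (mod int p)" by (simp add: h_def power_mult)
  then have "ord (int p) g dvd d * ord (int p) h"
    unfolding ord_int_power_cong_iff[OF g p_pos] by (simp add: cong_0_iff)
  then have "ord (int p) g \<le> d * ord (int p) h"
    using d0 ord_int_bounds(1)[OF h p] by (intro dvd_imp_le) auto
  then have "W \<le> d * ord (int p) h" using W_le_ord by linarith
  then have K: "K \<le> ord (int p) h" using d0 unfolding K_def
    by (metis div_le_mono nonzero_mult_div_cancel_left not_gr_zero)
  have L: "L \<le> p" unfolding L_def using Z_less div_le_dividend[of Z d] by linarith
  have "scaled_curve d = {(u, v). u \<in> {1..K} \<and> v \<in> {1..L} \<and> [int v = b * h ^ u] (mod int p)}"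
  proof -
    have "[int d * int v = a * g ^ (d * u)] (mod int p) \<longleftrightarrow> [int v = b * h ^ u] (mod int p)" for u v
    proof -
      have "[int d * (b * h ^ u) = a * g ^ (d * u)] (mod int p)"
        using cong_mult[OF db cong_refl[of "h ^ u"]] by (simp add: h_def power_mult mult.assoc)
      then have "[int d * int v = a * g ^ (d * u)] (mod int p) \<longleftrightarrow>
          [int d * int v = int d * (b * h ^ u)] (mod int p)"
        by (meson cong_sym cong_trans)
      also have "\<dots> \<longleftrightarrow> [int v = b * h ^ u] (mod int p)"
        by (rule cong_mult_lcancel[OF cd])
      finally show ?thesis .
    qed
    then show ?thesis unfolding scaled_curve_def K_def L_def by simp
  qed
  then have 1: "\<bar>real (card (scaled_curve d)) - real K * real L / real p\<bar> \<le> sqrt (real p) * (1 + 4 * harm p) ^ 2"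
    using card_exp_curve_box[OF p h b K L] by simp
  \<comment> \<open>Rounding each side moves it by at most 1 while the other side is at most p, so
    the area changes by at most 2 p and the main term by at most 2.\<close>
  define X Y where "X = U / real d" and "Y = V / real d"
  have XY: "real K \<le> X" "X \<le> real K + 1" "real L \<le> Y" "Y \<le> real L + 1"
    using div_W_le[of d] div_Z_le[of d] less_Suc_div[OF d0] unfolding X_def Y_def K_def L_def by auto
  have d1: "real d \<ge> 1" using d0 by simp
  have "X \<le> U" "Y \<le> V"
    using d1 U V unfolding X_def Y_def by (simp_all add: divide_le_eq mult_le_cancel_left1)
  then have XYp: "X \<le> real p" "Y \<le> real p" using U_less V_less by linarith+
  have "real K * real L \<le> X * Y" using XY by (intro mult_mono) auto
  moreover have "X * Y - real K * real L = (X - real K) * Y + real K * (Y - real L)"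
    by (simp add: algebra_simps)
  moreover have "(X - real K) * Y \<le> 1 * real p" using XY XYp by (intro mult_mono) auto
  moreover have "real K * (Y - real L) \<le> real p * 1" using XY XYp by (intro mult_mono) auto
  ultimately have "\<bar>real K * real L - X * Y\<bar> \<le> 2 * real p" by linarith
  then have "\<bar>real K * real L - X * Y\<bar> / real p \<le> 2"
    using p_pos by (simp add: divide_le_eq)
  moreover have "\<bar>real K * real L / real p - X * Y / real p\<bar> = \<bar>real K * real L - X * Y\<bar> / real p"
    by (simp add: diff_divide_distrib[symmetric])
  moreover have "X * Y / real p = U * V / (real d ^ 2 * real p)"
    by (simp add: X_def Y_def power2_eq_square)
  ultimately show ?thesis using 1 by linarith
qed

text \<open>The injectivity needed by \<open>product_curve_bound\<close> holds because v fixes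
  g^(du), and the exponents d u lie within one period of g.\<close>

lemma scaled_curve_product_bound:
  assumes d: "d \<in> {1..W}" and k: "k > 0" and T0: "T \<ge> 0"
    and T: "\<And>n. 0 < n \<Longrightarrow> n \<le> p ^ k \<Longrightarrow> real (card {e. e dvd n}) \<le> T"
  shows "real (card (scaled_curve d)) ^ k \<le> real k * (U / real d) * ((V / real d) ^ k / real p + 1) * T ^ k"
proof -
  have d0: "d > 0" using d by simp
  have inj: "inj_on snd (scaled_curve d)"
  proof (rule inj_onI)
    fix z z' assume z: "z \<in> scaled_curve d" "z' \<in> scaled_curve d" "snd z = snd z'"
    obtain u v u' where uv: "z = (u, v)" "z' = (u', v)" using z(3) by (cases z; cases z') auto
    have u: "u \<in> {1..W div d}" "u' \<in> {1..W div d}"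
      using z uv by (auto simp: scaled_curve_def)
    have "[a * g ^ (d * u) = a * g ^ (d * u')] (mod int p)"
      using z uv by (auto simp: scaled_curve_def intro: cong_trans cong_sym)
    then have "[g ^ (d * u) = g ^ (d * u')] (mod int p)" using cong_mult_lcancel[OF a] by blast
    then have c: "[d * u = d * u'] (mod ord (int p) g)"
      using ord_int_power_cong_iff[OF g p_pos] by blast
    have le: "d * w \<ge> 1" "d * w \<le> ord (int p) g" if "w \<in> {1..W div d}" for w
    proof -
      have "d * w \<le> W" using that d0 by (simp add: less_eq_div_iff_mult_less_eq mult.commute)
      then show "d * w \<le> ord (int p) g" using W_le_ord by linarith
      show "d * w \<ge> 1" using that d0 by simp
    qed
    \<comment> \<open>The exponents range over {1..t}; subtracting 1 puts them below the modulus,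
      where congruence is equality.\<close>
    have "[d * u - 1 = d * u' - 1] (mod ord (int p) g)"
      using c le(1)[OF u(1)] le(1)[OF u(2)] cong_add_rcancel_nat[of "d * u - 1" 1 "d * u' - 1"] by simp
    then have "d * u - 1 = d * u' - 1"
      using le[OF u(1)] le[OF u(2)] by (auto simp: cong_def)
    then have "d * u = d * u'" using le(1)[OF u(1)] le(1)[OF u(2)] by linarith
    then show "z = z'" using d0 uv by simp
  qed
  have "real (card (scaled_curve d)) ^ k
      \<le> (real k * real (W div d)) * (real ((Z div d) ^ k) / real p + 1) * T ^ k"
  proof (rule product_curve_bound[OF p coprime_of_le_W[OF d] k _ _ inj T0])
    fix n assume "0 < n" "n \<le> (Z div d) ^ k"
    moreover have "Z div d \<le> p" using Z_less div_le_dividend[of Z d] by linarith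
    then have "(Z div d) ^ k \<le> p ^ k" by (rule power_mono) simp
    ultimately show "real (card {e. e dvd n}) \<le> T" using T by simp
  qed (auto simp: scaled_curve_def)
  also have "\<dots> \<le> (real k * (U / real d)) * ((V / real d) ^ k / real p + 1) * T ^ k"
    using div_W_le[of d] div_Z_le[of d] T0 U V unfolding of_nat_power
    by (intro mult_right_mono mult_mono mult_left_mono add_mono divide_right_mono power_mono) auto
  finally show ?thesis by (simp add: mult.assoc)
qed

text \<open>The k-th root of the product bound, using y^k + 1 <= (y + 1)^k for y = V / (d
  p^(1/k)).\<close>

lemma scaled_curve_root_bound:
  assumes d: "d \<in> {1..W}" and k: "k > 0" and T0: "T \<ge> 0"
    and T: "\<And>n. 0 < n \<Longrightarrow> n \<le> p ^ k \<Longrightarrow> real (card {e. e dvd n}) \<le> T"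
  shows "real (card (scaled_curve d))
    \<le> real k * T * (U / real d) powr (1 / k) * (V / real d / real p powr (1 / k) + 1)"
proof (rule power_le_imp_le_base[of _ "k - 1"])
  define X Y where "X = U / real d" and "Y = V / real d"
  have XY: "X > 0" "Y > 0" using U V d by (auto simp: X_def Y_def)
  define P where "P = real p powr (1 / k)"
  have P: "P > 0" "P ^ k = real p"
    using p_pos k by (auto simp: P_def powr_realpow[symmetric] powr_powr)
  have Xk: "(X powr (1 / k)) ^ k = X" using XY k by (simp add: powr_realpow[symmetric] powr_powr)
  have "(Y / P) ^ k + 1 \<le> (Y / P + 1) ^ k"
  proof -
    have y: "Y / P \<ge> 0" using XY P by simp
    obtain j where j: "k = Suc j" using k by (cases k) auto
    have "(Y / P) ^ k + 1 = (Y / P) ^ j * (Y / P) + 1" by (simp add: j mult.commute)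
    also have "\<dots> \<le> (Y / P + 1) ^ j * (Y / P) + (Y / P + 1) ^ j"
      using y by (intro add_mono mult_right_mono power_mono one_le_power) auto
    also have "\<dots> = (Y / P + 1) ^ k" by (simp add: j algebra_simps)
    finally show ?thesis .
  qed
  then have A: "Y ^ k / real p + 1 \<le> (Y / P + 1) ^ k" using P by (simp add: power_divide)
  \<comment> \<open>The factor k is enlarged to k^k so that the whole right side becomes a perfect
    k-th power.\<close>
  have "real k \<le> real k ^ k" using k by (intro self_le_power) auto
  then have B: "real k * X \<le> real k ^ k * X" using XY by (intro mult_right_mono) auto
  have "real (card (scaled_curve d)) ^ Suc (k - 1) = real (card (scaled_curve d)) ^ k"
    using k by simp
  also have "\<dots> \<le> real k * X * (Y ^ k / real p + 1) * T ^ k"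
    unfolding X_def Y_def by (rule scaled_curve_product_bound[OF d k T0 T])
  also have "\<dots> \<le> real k ^ k * X * (Y / P + 1) ^ k * T ^ k"
    using A B XY P T0 by (intro mult_right_mono mult_mono) auto
  also have "\<dots> = (real k * T * X powr (1 / k) * (Y / P + 1)) ^ k"
    by (simp add: power_mult_distrib Xk)
  also have "\<dots> = (real k * T * X powr (1 / k) * (Y / P + 1)) ^ Suc (k - 1)" using k by simp
  finally show "real (card (scaled_curve d)) ^ Suc (k - 1) \<le>
      (real k * T * (U / real d) powr (1 / k) * (V / real d / real p powr (1 / k) + 1)) ^ Suc (k - 1)"
    by (simp only: X_def Y_def P_def)
  show "0 \<le> real k * T * (U / real d) powr (1 / k) * (V / real d / real p powr (1 / k) + 1)"
    using T0 U V by simp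
qed

text \<open>Since d > D forces u <= U/D and v <= V/D, the order of counting is reversed: for each
  such (u, v), \<open>twisted_fixed_points_bound\<close> limits the number of d.\<close>

lemma scaled_curve_large_sum:
  assumes D: "D \<ge> 1"
  shows "(\<Sum>d | d \<in> {1..W} \<and> real d > D. real (card (scaled_curve d)))
      \<le> 2 * harm p * U * V * D powr (-3/2)"
proof -
  define K L where "K = nat \<lfloor>U / D\<rfloor>" and "L = nat \<lfloor>V / D\<rfloor>"
  define S where "S u v = {d\<in>{1..W div u}. [int d * int v = a * g ^ (d * u)] (mod int p)}" for u v
  have KL: "real K \<le> U / D" "real L \<le> V / D"
    unfolding K_def L_def using U V D by (auto intro!: of_nat_floor)
  have "U / D \<le> U" "V / D \<le> V"
    using U V D by (simp_all add: divide_le_eq mult_le_cancel_left1)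
  then have KLp: "K < p" "L < p" using KL U_less V_less by linarith+
  have "(\<Sum>d | d \<in> {1..W} \<and> real d > D. real (card (scaled_curve d)))
      = real (card (Sigma {d \<in> {1..W}. real d > D} scaled_curve))"
    by simp
  also have "\<dots> \<le> real (card (Sigma ({1..K} \<times> {1..L}) (\<lambda>(u, v). S u v)))"
  proof (unfold of_nat_le_iff, rule card_inj_on_le)
    show "inj_on (\<lambda>(d, z). (z, d)) (Sigma {d \<in> {1..W}. real d > D} scaled_curve)"
      by (auto simp: inj_on_def)
    show "finite (Sigma ({1..K} \<times> {1..L}) (\<lambda>(u, v). S u v))" by (auto simp: S_def)
    show "(\<lambda>(d, z). (z, d)) ` Sigma {d \<in> {1..W}. real d > D} scaled_curve
        \<subseteq> Sigma ({1..K} \<times> {1..L}) (\<lambda>(u, v). S u v)"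
    proof (rule image_subsetI)
      fix w assume "w \<in> Sigma {d \<in> {1..W}. real d > D} scaled_curve"
      then obtain d u v where w: "w = (d, u, v)" and d: "d \<in> {1..W}" "D < real d"
        and uv: "(u, v) \<in> scaled_curve d" by auto
      have u: "1 \<le> u" "u \<le> W div d" and v: "1 \<le> v" "v \<le> Z div d"
        and c: "[int d * int v = a * g ^ (d * u)] (mod int p)"
        using uv by (auto simp: scaled_curve_def)
      have "U / real d \<le> U / D" "V / real d \<le> V / D"
        using d D U V by (auto intro!: divide_left_mono)
      then have "real u \<le> U / D" "real v \<le> V / D"
        using u v div_W_le[of d] div_Z_le[of d] by linarith+
      then have "u \<le> K" "v \<le> L" unfolding K_def L_def by (simp_all add: le_nat_floor)
      moreover have "d \<le> W div u"
        using u d by (simp add: less_eq_div_iff_mult_less_eq mult.commute)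
      ultimately show "(case w of (d, z) \<Rightarrow> (z, d)) \<in> Sigma ({1..K} \<times> {1..L}) (\<lambda>(u, v). S u v)"
        using u v d c w by (simp add: S_def)
    qed
  qed
  also have "\<dots> = (\<Sum>(u, v)\<in>{1..K} \<times> {1..L}. real (card (S u v)))"
    by (simp add: S_def case_prod_unfold)
  also have "\<dots> = (\<Sum>u\<in>{1..K}. \<Sum>v\<in>{1..L}. real (card (S u v)))"
    by (simp add: sum.cartesian_product)
  also have "\<dots> \<le> (\<Sum>u\<in>{1..K}. \<Sum>v\<in>{1..L}. 2 * sqrt U * sqrt (U / D) * inverse (real u))"
  proof (intro sum_mono)
    fix u v assume u: "u \<in> {1..K}" and v: "v \<in> {1..L}"
    have u0: "real u > 0" using u by simp
    have "coprime v p" using v KLp by (intro coprime_prime_less[OF p]) auto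
    moreover have "W div u < p" using W_less div_le_dividend[of W u] by linarith
    ultimately have "card (S u v) ^ 2 \<le> 3 * (W div u)"
      by (intro twisted_fixed_points_bound[OF p]) (auto simp: S_def)
    then have "real (card (S u v)) ^ 2 \<le> 3 * real (W div u)"
      by (metis of_nat_le_iff of_nat_mult of_nat_numeral of_nat_power)
    also have "\<dots> \<le> 4 * (U / real u)" using div_W_le[of u] U u0 by simp
    \<comment> \<open>The size U/u is rewritten as U u / u^2 and u is replaced by U/D, so that after
      the square root the sum over u is harmonic.\<close>
    also have "\<dots> = 4 * U * real u * (1 / real u) ^ 2" using u0 by (simp add: power2_eq_square)
    also have "\<dots> \<le> 4 * U * (U / D) * (1 / real u) ^ 2"
      using U KL u by (intro mult_right_mono mult_left_mono) auto
    also have "\<dots> = (2 * sqrt U * sqrt (U / D) * inverse (real u)) ^ 2"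
      using U D by (simp add: power_mult_distrib power_divide power_inverse inverse_eq_divide mult.commute)
    finally show "real (card (S u v)) \<le> 2 * sqrt U * sqrt (U / D) * inverse (real u)"
      by (rule power2_le_imp_le) (use U D in auto)
  qed
  also have "\<dots> = real L * (2 * sqrt U * sqrt (U / D)) * harm K"
    by (simp add: harm_def sum_distrib_left mult_ac)
  also have "\<dots> \<le> (V / D) * (2 * sqrt U * sqrt (U / D)) * harm p"
    using KL KLp U V D harm_mono[of K p, where 'a = real] harm_nonneg by (intro mult_mono) auto
  also have "\<dots> = 2 * harm p * U * V * D powr (-3/2)"
  proof -
    have "sqrt U * sqrt (U / D) = U * D powr (-1/2)"
      using U D by (simp add: real_sqrt_divide powr_minus powr_half_sqrt field_simps flip: minus_divide_left)
    moreover have "D powr (-3/2) = D powr (-1/2) / D"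
    proof -
      have "D powr (-3/2) = D powr (-1/2 - 1)" by simp
      also have "\<dots> = D powr (-1/2) / D" using D by (subst powr_diff) simp
      finally show ?thesis .
    qed
    ultimately show ?thesis by (simp add: mult_ac)
  qed
  finally show ?thesis .
qed

end

section \<open>Monomials in U, V and p\<close>

context exp_curve_box
begin

text \<open>All quantities compared below have this shape. Taking logarithms reduces each comparison
  to a linear inequality between ln U, ln V and ln p.\<close>

definition monomial :: "real \<Rightarrow> real \<Rightarrow> real \<Rightarrow> real" where
  "monomial i j k = U powr i * V powr j * real p powr k"

lemma monomial_exp: "monomial i j k = exp (i * ln U + j * ln V + k * ln (real p))"
  using U V p_pos by (simp add: monomial_def powr_def exp_add)

lemma monomial_pos [simp]: "monomial i j k > 0"
  by (simp add: monomial_exp)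

lemma monomial_mult: "monomial i j k * monomial i' j' k' = monomial (i + i') (j + j') (k + k')"
  by (simp add: monomial_exp exp_add[symmetric] distrib_right)

lemma monomial_divide: "monomial i j k / monomial i' j' k' = monomial (i - i') (j - j') (k - k')"
  by (simp add: monomial_exp exp_diff[symmetric] left_diff_distrib)

lemma monomial_powr: "monomial i j k powr r = monomial (i * r) (j * r) (k * r)"
  by (simp add: monomial_exp powr_def algebra_simps)

lemma monomial_le_iff:
  "monomial i j k \<le> monomial i' j' k' \<longleftrightarrow>
     i * ln U + j * ln V + k * ln (real p) \<le> i' * ln U + j' * ln V + k' * ln (real p)"
  by (simp add: monomial_exp)

lemma monomial_0 [simp]: "monomial 0 0 0 = 1"
  by (simp add: monomial_exp)

lemma monomial_basic: "U = monomial 1 0 0" "V = monomial 0 1 0" "real p = monomial 0 0 1"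
  using U V p_pos by (simp_all add: monomial_exp)

text \<open>\<open>err1\<close> and \<open>err2\<close> are the two terms of the claimed error,
  without the factor p^\<epsilon>.\<close>

definition err1 :: real where "err1 = monomial (3/4) (1/4) (-1/8)"
definition err2 :: real where "err2 = monomial (1/4) (5/8) 0"

end

section \<open>Ranges of d under the hypothesis U^3 V >= p^(5/2)\<close>

text \<open>\<open>T\<close> stands for the divisor bound. It has to cover integers up to p^3, since
  products of at most three v-coordinates occur.\<close>

locale large_exp_curve_box = exp_curve_box +
  fixes T :: real
  assumes large: "U ^ 3 * V \<ge> real p powr (5/2)"
    and T: "T \<ge> 1" "\<And>n. 0 < n \<Longrightarrow> n \<le> p ^ 3 \<Longrightarrow> real (card {e. e dvd n}) \<le> T"
begin

definition c :: real where "c = 1 + 4 * harm p"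

lemma ln_bounds:
  "ln U \<le> ln (real p)" "ln V \<le> ln (real p)" "0 \<le> ln (real p)"
  "3 * ln U + ln V \<ge> 5 / 2 * ln (real p)" "ln U \<ge> ln (real p) / 2"
proof -
  have "monomial 0 0 (5/2) \<le> monomial 3 1 0"
    using large U V p_pos by (simp add: monomial_def powr_numeral)
  then show 1: "3 * ln U + ln V \<ge> 5 / 2 * ln (real p)" unfolding monomial_le_iff by simp
  show "ln U \<le> ln (real p)" using U_less U p_pos by simp
  show 2: "ln V \<le> ln (real p)" using V_less V p_pos by simp
  show "0 \<le> ln (real p)" using p_pos by simp
  show "ln U \<ge> ln (real p) / 2" using 1 2 by simp
qed

lemma T_le:
  assumes "k \<le> 3" "0 < n" "n \<le> p ^ k"
  shows "real (card {e. e dvd n}) \<le> T"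
proof (rule T(2)[OF assms(2)])
  have "p ^ k \<le> p ^ 3" using assms(1) p_pos by (intro power_increasing) auto
  then show "n \<le> p ^ 3" using assms(3) by linarith
qed

lemma c_ge_1: "c \<ge> 1" and harm_le_c: "harm p \<le> c" "2 * harm p \<le> c" "4 * harm p \<le> c"
  using harm_nonneg[of p, where 'a = real] unfolding c_def by linarith+

lemma one_in_range: "1 \<in> {1..W}"
proof -
  have "monomial 0 0 0 \<le> monomial 1 0 0" unfolding monomial_le_iff using ln_bounds by simp
  then have "1 \<le> U" by (simp add: monomial_basic[symmetric])
  then show ?thesis by (simp add: W_def le_nat_iff)
qed

text \<open>The root bound multiplied by d: once the right side is bounded independently of d,
  summing over d costs only a harmonic factor.\<close>

lemma scaled_curve_pointwise:
  assumes d: "d \<in> {1..W}" and k: "k > 0" "k \<le> 3"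
  shows "real d * real (card (scaled_curve d)) \<le> real k * T *
    (monomial (1 / k) 0 0 * real d powr (1 - 1 / k) + monomial (1 / k) 1 (- 1 / k) * real d powr (- 1 / k))"
proof -
  have d0: "real d > 0" using d by simp
  define r where "r = 1 / real k"
  have "real (card (scaled_curve d)) \<le> real k * T * (U / real d) powr r * (V / real d / real p powr r + 1)"
    unfolding r_def using T(1) T_le[OF k(2)] by (intro scaled_curve_root_bound[OF d k(1)]) auto
  then have "real d * real (card (scaled_curve d)) \<le>
      real d * (real k * T * (U / real d) powr r * (V / real d / real p powr r + 1))"
    by (rule mult_left_mono) simp
  also have "\<dots> = real k * T * (U powr r * (real d / real d powr r) + U powr r * V / real p powr r * (1 / real d powr r))"
    using d0 U by (simp add: powr_divide field_simps)
  also have "real d / real d powr r = real d powr (1 - r)" using d0 by (simp add: powr_diff)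
  also have "1 / real d powr r = real d powr (- r)" using d0 by (simp add: powr_minus_divide)
  also have "U powr r = monomial r 0 0" using V p_pos by (simp add: monomial_def)
  also have "monomial r 0 0 * V / real p powr r = monomial r 1 (- r)"
    using V p_pos by (simp add: monomial_def powr_minus_divide)
  finally show ?thesis unfolding r_def by simp
qed

lemma visible_count_le_curve:
  assumes VU: "V \<le> U" and UV: "U * V \<le> real p powr (3/2)"
  shows "\<bar>real (visible_count a g p U V) - 6 / pi\<^sup>2 * (U * V / real p)\<bar> \<le> 5 * T * err1"
proof -
  have l1: "ln V \<le> ln U" using VU V by simp
  have "monomial 1 1 0 \<le> monomial 0 0 (3/2)" using UV U V p_pos by (simp add: monomial_def)
  then have l2: "ln U + ln V \<le> 3 / 2 * ln (real p)" unfolding monomial_le_iff by simp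
  have "card {(x, y) \<in> curve. coprime x y} \<le> card curve" by (rule card_mono) auto
  moreover have "scaled_curve 1 = curve" by (simp add: curve_def scaled_curve_def)
  ultimately have "real (visible_count a g p U V) \<le> real (card (scaled_curve 1))"
    unfolding visible_count_eq by (simp only: of_nat_le_iff)
  also have "\<dots> \<le> 2 * T * (monomial (1/2) 0 0 + monomial (1/2) 1 (-1/2))"
    using scaled_curve_pointwise[OF one_in_range, of 2] by simp
  \<comment> \<open>For the second monomial the claim is V^3 <= U p^(3/2), the product of V <= U and
    V^2 <= U V <= p^(3/2).\<close>
  also have "\<dots> \<le> 2 * T * (err1 + err1)"
    unfolding err1_def using T(1) ln_bounds l1 l2
    by (intro mult_left_mono add_mono) (auto simp: monomial_le_iff)
  finally have 1: "real (visible_count a g p U V) \<le> 4 * T * err1" by simp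
  have "6 / pi\<^sup>2 * (U * V / real p) \<le> 1 * (U * V / real p)"
  proof (rule mult_right_mono)
    have "pi\<^sup>2 \<ge> 9" using power_mono[of 3 pi 2] pi_gt3 by simp
    then show "6 / pi\<^sup>2 \<le> 1" by simp
  qed (use U V in simp)
  also have "1 * (U * V / real p) = monomial 1 1 (-1)"
    using U V p_pos by (simp add: monomial_def powr_minus_divide)
  also have "\<dots> \<le> err1" unfolding err1_def monomial_le_iff using ln_bounds l1 l2 by simp
  also have "\<dots> \<le> T * err1" using T(1) by (simp add: err1_def)
  finally have 2: "6 / pi\<^sup>2 * (U * V / real p) \<le> T * err1" .
  have 3: "0 \<le> 6 / pi\<^sup>2 * (U * V / real p)" using U V by simp
  have 4: "0 \<le> real (visible_count a g p U V)" by simp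
  have "\<bar>x - y\<bar> \<le> 4 * z + z" if "0 \<le> x" "x \<le> 4 * z" "0 \<le> y" "y \<le> z" for x y z :: real
    using that by linarith
  from this[of "real (visible_count a g p U V)" "T * err1" "6 / pi\<^sup>2 * (U * V / real p)"] 1 2 3 4
  show ?thesis by simp
qed

text \<open>The terms of the root bound that grow with d favour small k and the decaying ones need d
  large. Passing from k = 2 to k = 3 at d = V^(5/4) U^(-1/2) keeps both within the error.\<close>

lemma scaled_curve_middle:
  assumes d: "d \<in> {1..W}" and VU: "\<not> (V \<le> U \<and> U * V \<le> real p powr (3/2))"
    and D: "monomial (3/4) (1/4) (-5/8) < real d" "real d \<le> monomial (1/2) (1/4) 0"
  shows "real (card (scaled_curve d)) \<le> 4 * T * (err1 + err2) * inverse (real d)"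
proof -
  have d0: "real d > 0" using d by simp
  have e: "err1 > 0" "err2 > 0" by (auto simp: err1_def err2_def)
  have "real d * real (card (scaled_curve d)) \<le> 4 * T * (err1 + err2)"
  proof (cases "real d \<le> monomial (-1/2) (5/4) 0")
    case True
    \<comment> \<open>The switching point is chosen so that the growing term U^(1/2) d^(1/2) reaches
      exactly \<open>err2\<close> there.\<close>
    have "real d powr (1/2) \<le> monomial (-1/2) (5/4) 0 powr (1/2)"
      using True d0 by (intro powr_mono2) auto
    then have "monomial (1/2) 0 0 * real d powr (1/2) \<le> monomial (1/2) 0 0 * monomial (-1/4) (5/8) 0"
      by (simp add: monomial_powr)
    then have 1: "monomial (1/2) 0 0 * real d powr (1/2) \<le> err2"
      by (simp add: monomial_mult err2_def)
    have "real d powr (-1/2) \<le> monomial (3/4) (1/4) (-5/8) powr (-1/2)"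
      using D by (intro powr_mono2') auto
    then have "monomial (1/2) 1 (-1/2) * real d powr (-1/2) \<le> monomial (1/2) 1 (-1/2) * monomial (-3/8) (-1/8) (5/16)"
      by (simp add: monomial_powr)
    also have "\<dots> \<le> err2"
      unfolding monomial_mult err2_def monomial_le_iff using ln_bounds by simp
    finally have 2: "monomial (1/2) 1 (-1/2) * real d powr (-1/2) \<le> err2" .
    have "real d * real (card (scaled_curve d)) \<le>
        2 * T * (monomial (1/2) 0 0 * real d powr (1/2) + monomial (1/2) 1 (-1/2) * real d powr (-1/2))"
      using scaled_curve_pointwise[OF d, of 2] by simp
    also have "\<dots> \<le> 2 * T * (err2 + err2)"
      using 1 2 T(1) by (intro mult_left_mono add_mono) auto
    also have "\<dots> = 4 * T * err2" by simp
    also have "\<dots> \<le> 4 * T * (err1 + err2)" using T(1) e by (intro mult_left_mono) auto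
    finally show ?thesis .
  next
    case False
    \<comment> \<open>A nonempty range for k = 3 forces V <= U, and the excluded case then leaves U
      V >= p^(3/2).\<close>
    then have "monomial (-1/2) (5/4) 0 < monomial (1/2) (1/4) 0" using D by linarith
    then have "\<not> monomial (1/2) (1/4) 0 \<le> monomial (-1/2) (5/4) 0" by linarith
    then have "ln V \<le> ln U" unfolding monomial_le_iff by simp
    then have "V \<le> U" using U V by simp
    then have "real p powr (3/2) \<le> U * V" using VU by simp
    then have "monomial 0 0 (3/2) \<le> monomial 1 1 0" using U V p_pos by (simp add: monomial_def)
    then have l: "3 / 2 * ln (real p) \<le> ln U + ln V" unfolding monomial_le_iff by simp
    have "real d powr (2/3) \<le> monomial (1/2) (1/4) 0 powr (2/3)"
      using D d0 by (intro powr_mono2) auto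
    then have "monomial (1/3) 0 0 * real d powr (2/3) \<le> monomial (1/3) 0 0 * monomial (1/3) (1/6) 0"
      by (simp add: monomial_powr)
    \<comment> \<open>The inequality U^(2/3) V^(1/6) <= \<open>err1\<close> is equivalent to U V >=
      p^(3/2).\<close>
    also have "\<dots> \<le> err1"
      unfolding monomial_mult err1_def monomial_le_iff using ln_bounds l by simp
    finally have 1: "monomial (1/3) 0 0 * real d powr (2/3) \<le> err1" .
    have "real d powr (-1/3) \<le> monomial (-1/2) (5/4) 0 powr (-1/3)"
      using False by (intro powr_mono2') auto
    then have "monomial (1/3) 1 (-1/3) * real d powr (-1/3) \<le> monomial (1/3) 1 (-1/3) * monomial (1/6) (-5/12) 0"
      by (simp add: monomial_powr)
    also have "\<dots> \<le> err2"
      unfolding monomial_mult err2_def monomial_le_iff using ln_bounds by simp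
    finally have 2: "monomial (1/3) 1 (-1/3) * real d powr (-1/3) \<le> err2" .
    have "real d * real (card (scaled_curve d)) \<le>
        3 * T * (monomial (1/3) 0 0 * real d powr (2/3) + monomial (1/3) 1 (-1/3) * real d powr (-1/3))"
      using scaled_curve_pointwise[OF d, of 3] by simp
    also have "\<dots> \<le> 3 * T * (err1 + err2)"
      using 1 2 T(1) by (intro mult_left_mono add_mono) auto
    also have "\<dots> \<le> 4 * T * (err1 + err2)" using T(1) e by (intro mult_right_mono) auto
    finally show ?thesis .
  qed
  then show ?thesis using d0 by (simp add: field_simps)
qed

end

section \<open>Assembling the ranges\<close>

context large_exp_curve_box
begin

lemma visible_count_estimate:
  "\<bar>real (visible_count a g p U V) - 6 / pi\<^sup>2 * (U * V / real p)\<bar> \<le> 9 * c\<^sup>2 * T * (err1 + err2)"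
proof (cases "V \<le> U \<and> U * V \<le> real p powr (3/2)")
  case True
  have e: "err1 > 0" "err2 > 0" by (auto simp: err1_def err2_def)
  have "5 * T * err1 \<le> 9 * c\<^sup>2 * T * (err1 + err2)"
  proof (rule mult_mono)
    show "5 * T \<le> 9 * c\<^sup>2 * T"
      using T(1) one_le_power[OF c_ge_1, of 2] by (intro mult_right_mono) auto
  qed (use e T(1) in auto)
  then show ?thesis using visible_count_le_curve True by fastforce
next
  case False
  have e: "err1 > 0" "err2 > 0" by (auto simp: err1_def err2_def)
  have c2: "c \<le> c\<^sup>2" "1 \<le> c\<^sup>2"
    using c_ge_1 one_le_power[OF c_ge_1, of 2] by (auto simp: power2_eq_square)
  \<comment> \<open>With this cutoff, D0 sqrt p = \<open>err1\<close>: the errors of size sqrt p for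
    d <= D0 add up to the first error term.\<close>
  define D0 where "D0 = monomial (3/4) (1/4) (-5/8)"
  \<comment> \<open>With this cutoff, U V B^(-3/2) = \<open>err2\<close>, the size of the
    contribution from d > B.\<close>
  define B where "B = monomial (1/2) (1/4) 0"
  define X where "X = U * V / real p"
  define m where "m d = real (card (scaled_curve d))" for d
  define D where "D = nat \<lfloor>D0\<rfloor>"
  have X: "X = monomial 1 1 (-1)" "X > 0"
    using U V p_pos by (auto simp: X_def monomial_def powr_minus_divide)
  have "monomial 0 0 0 \<le> D0" unfolding D0_def monomial_le_iff using ln_bounds by simp
  then have D0_1: "1 \<le> D0" by simp
  have "D0 \<le> monomial 1 0 0" unfolding D0_def monomial_le_iff using ln_bounds by simp
  then have D0_U: "D0 \<le> U" by (simp add: monomial_basic[symmetric])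
  have "monomial 0 0 0 \<le> B" unfolding B_def monomial_le_iff using ln_bounds by simp
  then have B1: "1 \<le> B" by simp
  have D1: "1 \<le> D" unfolding D_def using D0_1 by (simp add: le_nat_iff)
  have DW: "D \<le> W" unfolding D_def W_def using D0_U by (intro nat_mono floor_mono)
  have DD0: "real D \<le> D0" "D0 < real D + 1" unfolding D_def using D0_1 by linarith+
  then have D02: "D0 \<le> 2 * real D" using D1 by linarith
  \<comment> \<open>Three sources of error: the approximation of \<open>m d\<close> for d <= D, the
    truncation of the series for 6/pi^2, and all the terms with d > D.\<close>
  define S1 where "S1 = (\<Sum>d\<in>{1..D}. moebius d * (m d - X / real d ^ 2))"
  define S2 where "S2 = X * ((\<Sum>d\<in>{1..D}. moebius d / real d ^ 2) - 6 / pi\<^sup>2)"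
  define S3 where "S3 = (\<Sum>d\<in>{D<..W}. moebius d * m d)"
  have "real (visible_count a g p U V) = (\<Sum>d\<in>{1..D}. moebius d * m d) + S3"
  proof -
    have "{1..W} = {1..D} \<union> {D<..W}" using DW by auto
    then show ?thesis unfolding visible_count_moebius S3_def m_def
      by (simp only:) (rule sum.union_disjoint; auto)
  qed
  also have "(\<Sum>d\<in>{1..D}. moebius d * m d) = S1 + X * (\<Sum>d\<in>{1..D}. moebius d / real d ^ 2)"
    unfolding S1_def by (simp add: right_diff_distrib sum_subtractf sum_distrib_left mult_ac)
  finally have split: "real (visible_count a g p U V) - 6 / pi\<^sup>2 * X = S1 + S2 + S3"
    unfolding S2_def by (simp add: right_diff_distrib mult_ac)
  have sqrtp: "sqrt (real p) = monomial 0 0 (1/2)" "1 \<le> sqrt (real p)"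
    using U V p_pos by (simp_all add: monomial_def powr_half_sqrt)
  have S1: "\<bar>S1\<bar> \<le> 3 * c\<^sup>2 * err1"
  proof -
    have "\<bar>S1\<bar> \<le> (\<Sum>d\<in>{1..D}. \<bar>moebius d * (m d - X / real d ^ 2)\<bar>)"
      unfolding S1_def by (rule sum_abs)
    also have "\<dots> \<le> (\<Sum>d\<in>{1..D}. 3 * c\<^sup>2 * sqrt (real p))"
    proof (rule sum_mono)
      fix d assume "d \<in> {1..D}"
      then have "d \<in> {1..W}" using DW by simp
      then have "\<bar>m d - X / real d ^ 2\<bar> \<le> sqrt (real p) * c\<^sup>2 + 2"
        using scaled_curve_asymp[of d] unfolding m_def c_def X_def by (simp add: mult.commute)
      also have "2 \<le> 2 * (sqrt (real p) * c\<^sup>2)"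
        using mult_mono[OF sqrtp(2) c2(2)] by simp
      finally have "\<bar>m d - X / real d ^ 2\<bar> \<le> 3 * c\<^sup>2 * sqrt (real p)"
        by (simp add: mult_ac)
      then show "\<bar>moebius d * (m d - X / real d ^ 2)\<bar> \<le> 3 * c\<^sup>2 * sqrt (real p)"
        unfolding abs_mult using mult_mono[OF abs_moebius_le_1[of d]] by fastforce
    qed
    also have "\<dots> = real D * (3 * c\<^sup>2 * sqrt (real p))" by simp
    also have "\<dots> \<le> D0 * (3 * c\<^sup>2 * sqrt (real p))"
      using DD0 by (intro mult_right_mono) auto
    also have "\<dots> = 3 * c\<^sup>2 * (D0 * monomial 0 0 (1/2))" by (simp add: sqrtp(1))
    also have "D0 * monomial 0 0 (1/2) = err1" by (simp add: D0_def monomial_mult err1_def)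
    finally show ?thesis .
  qed
  have S2: "\<bar>S2\<bar> \<le> c\<^sup>2 * err2"
  proof -
    have "\<bar>S2\<bar> \<le> X * (2 * harm D / real D)"
      unfolding S2_def abs_mult using X(2) D1 sum_moebius_over_squares[of D]
      by (intro mult_mono) auto
    also have "2 * harm D / real D \<le> 2 * harm D / (D0 / 2)"
      using D02 D0_1 D1 harm_nonneg[of D, where 'a = real] by (intro divide_left_mono) auto
    then have "X * (2 * harm D / real D) \<le> X * (2 * harm D / (D0 / 2))"
      using X(2) by (intro mult_left_mono) auto
    also have "\<dots> = 4 * harm D * (X / D0)" by simp
    also have "\<dots> \<le> c\<^sup>2 * err2"
    proof (rule mult_mono)
      have "harm D \<le> (harm p :: real)" using DW W_less by (intro harm_mono) simp
      then show "4 * harm D \<le> c\<^sup>2" using harm_le_c c2 by linarith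
      show "X / D0 \<le> err2"
        unfolding X(1) D0_def monomial_divide err2_def monomial_le_iff using ln_bounds by simp
    qed (use X(2) D0_1 c_ge_1 in auto)
    finally show ?thesis .
  qed
  have S3: "\<bar>S3\<bar> \<le> 4 * c\<^sup>2 * T * (err1 + err2) + c\<^sup>2 * err2"
  proof -
    have "\<bar>S3\<bar> \<le> (\<Sum>d\<in>{D<..W}. \<bar>moebius d * m d\<bar>)"
      unfolding S3_def by (rule sum_abs)
    also have "\<dots> \<le> (\<Sum>d\<in>{D<..W}. m d)"
    proof (rule sum_mono)
      fix d
      have "\<bar>moebius d\<bar> * m d \<le> 1 * m d"
        by (intro mult_right_mono abs_moebius_le_1) (simp add: m_def)
      then show "\<bar>moebius d * m d\<bar> \<le> m d" by (simp add: abs_mult m_def)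
    qed
    \<comment> \<open>The terms are now nonnegative, so the part above B may be taken over all of
      {1..W}, as in \<open>scaled_curve_large_sum\<close>.\<close>
    also have "\<dots> \<le> (\<Sum>d\<in>{d\<in>{D<..W}. real d \<le> B} \<union> {d. d \<in> {1..W} \<and> real d > B}. m d)"
      by (intro sum_mono2) (auto simp: m_def)
    also have "\<dots> = (\<Sum>d\<in>{d\<in>{D<..W}. real d \<le> B}. m d) + (\<Sum>d | d \<in> {1..W} \<and> real d > B. m d)"
      by (intro sum.union_disjoint) auto
    also have "(\<Sum>d\<in>{d\<in>{D<..W}. real d \<le> B}. m d) \<le>
        (\<Sum>d\<in>{d\<in>{D<..W}. real d \<le> B}. 4 * T * (err1 + err2) * inverse (real d))"
    proof (rule sum_mono)
      fix d assume d: "d \<in> {d\<in>{D<..W}. real d \<le> B}"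
      then have "real d \<ge> real D + 1" by simp
      then have "D0 < real d" using DD0 by linarith
      moreover have "d \<in> {1..W}" using d by simp
      ultimately show "m d \<le> 4 * T * (err1 + err2) * inverse (real d)"
        using scaled_curve_middle[of d] False d unfolding m_def D0_def B_def by blast
    qed
    also have "\<dots> \<le> (\<Sum>d\<in>{1..p}. 4 * T * (err1 + err2) * inverse (real d))"
      using W_less T(1) e by (intro sum_mono2) auto
    also have "\<dots> = 4 * T * (err1 + err2) * harm p" by (simp add: harm_def sum_distrib_left)
    also have "\<dots> \<le> 4 * T * (err1 + err2) * c\<^sup>2"
      using T(1) e harm_le_c(1) c2 by (intro mult_left_mono) auto
    also have "\<dots> = 4 * c\<^sup>2 * T * (err1 + err2)" by simp
    also have "(\<Sum>d | d \<in> {1..W} \<and> real d > B. m d) \<le> c\<^sup>2 * err2"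
    proof -
      have "(\<Sum>d | d \<in> {1..W} \<and> real d > B. m d) \<le> 2 * harm p * U * V * B powr (-3/2)"
        unfolding m_def by (rule scaled_curve_large_sum[OF B1])
      also have "\<dots> = 2 * harm p * (monomial 1 0 0 * monomial 0 1 0 * B powr (-3/2))"
        by (simp add: monomial_basic[symmetric] mult.assoc)
      also have "monomial 1 0 0 * monomial 0 1 0 * B powr (-3/2) = err2"
        by (simp add: B_def monomial_powr monomial_mult err2_def)
      also have "2 * harm p * err2 \<le> c\<^sup>2 * err2"
        using e harm_le_c(2) c2 by (intro mult_right_mono) auto
      finally show ?thesis .
    qed
    finally show ?thesis by simp
  qed
  \<comment> \<open>The coefficients 3 of \<open>err1\<close> and 1 + 1 of \<open>err2\<close> are
    absorbed into 5, which with the 4 from the middle range gives 9.\<close>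
  have "\<bar>real (visible_count a g p U V) - 6 / pi\<^sup>2 * X\<bar> \<le>
      3 * c\<^sup>2 * err1 + c\<^sup>2 * err2 + (4 * c\<^sup>2 * T * (err1 + err2) + c\<^sup>2 * err2)"
    unfolding split using S1 S2 S3 by linarith
  also have "\<dots> \<le> 5 * (c\<^sup>2 * (err1 + err2)) + 4 * c\<^sup>2 * T * (err1 + err2)"
  proof -
    have "0 \<le> err1 * c\<^sup>2" "0 \<le> err2 * c\<^sup>2" using e by simp_all
    then show ?thesis by (simp add: distrib_left)
  qed
  also have "\<dots> \<le> 5 * (c\<^sup>2 * (err1 + err2) * T) + 4 * c\<^sup>2 * T * (err1 + err2)"
  proof -
    have "c\<^sup>2 * (err1 + err2) * 1 \<le> c\<^sup>2 * (err1 + err2) * T"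
      using e T(1) by (intro mult_left_mono) auto
    then show ?thesis by (simp add: mult_ac)
  qed
  also have "\<dots> = 9 * c\<^sup>2 * T * (err1 + err2)" by (simp add: algebra_simps)
  finally show ?thesis unfolding X_def .
qed

end

theorem theorem1p1:
  fixes \<epsilon> :: real
  assumes "\<epsilon> > 0"
  shows "\<exists>C>0. \<forall>(p::nat) (a::int) (g::int) (t::nat) (U::real) (V::real).
    prime p \<longrightarrow> gcd a (int p) = 1 \<longrightarrow> gcd g (int p) = 1 \<longrightarrow> ord (int p) g = t \<longrightarrow>
    0 < U \<longrightarrow> 0 < V \<longrightarrow> U \<le> real t \<longrightarrow> V \<le> real t \<longrightarrow>
    U ^ 3 * V \<ge> real p powr (5 / 2) \<longrightarrow>
    \<bar>real (visible_count a g p U V) - 6 / pi\<^sup>2 * (U * V / real p)\<bar>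
      \<le> C * ((U powr (3 / 4) * V powr (1 / 4) / real p powr (1 / 8)
              + U powr (1 / 4) * V powr (5 / 8)) * real p powr \<epsilon>)"
proof -
  \<comment> \<open>Integers up to p^3 raised to \<epsilon>/6 cost p^(\<epsilon>/2), half of the
    allowed power.\<close>
  obtain C2 where C2: "C2 \<ge> 1"
    and div: "\<And>n::nat. n > 0 \<Longrightarrow> real (card {d. d dvd n}) \<le> C2 * real n powr (\<epsilon> / 6)"
    using divisor_bound[of "\<epsilon> / 6"] assms by auto
  \<comment> \<open>The constant of \<open>harm_le_powr\<close> for exponent \<epsilon>/4; the
    logarithmic factor enters squared and so uses the other p^(\<epsilon>/2).\<close>
  define C1 where "C1 = 5 + 4 / (\<epsilon> / 4)"
  have C1: "C1 > 0" using assms by (simp add: C1_def add_pos_pos)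
  show ?thesis
  proof (intro exI[of _ "9 * C1\<^sup>2 * C2"] conjI allI impI)
    show "9 * C1\<^sup>2 * C2 > 0" using C1 C2 by simp
    fix p :: nat and a g :: int and t :: nat and U V :: real
    assume p: "prime p" and "gcd a (int p) = 1" "gcd g (int p) = 1" "ord (int p) g = t"
      and "0 < U" "0 < V" "U \<le> real t" "V \<le> real t" "U ^ 3 * V \<ge> real p powr (5 / 2)"
    define T where "T = C2 * real p powr (\<epsilon> / 2)"
    have p1: "real p \<ge> 1" using prime_gt_0_nat[OF p] by simp
    have "1 \<le> real p powr (\<epsilon> / 2)" using p1 assms by (intro ge_one_powr_ge_zero) auto
    then have T1: "T \<ge> 1" using C2 mult_mono[of 1 C2 1] by (simp add: T_def)
    have T: "real (card {e. e dvd n}) \<le> T" if "0 < n" "n \<le> p ^ 3" for n :: nat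
    proof -
      have "real n \<le> real (p ^ 3)" using that(2) by (simp only: of_nat_le_iff)
      then have "real n powr (\<epsilon> / 6) \<le> (real p ^ 3) powr (\<epsilon> / 6)"
        using assms by (intro powr_mono2) auto
      also have "\<dots> = real p powr (\<epsilon> / 2)"
        using p1 by (simp add: powr_realpow[symmetric] powr_powr flip: powr_numeral)
      finally have "C2 * real n powr (\<epsilon> / 6) \<le> T"
        unfolding T_def using C2 by (intro mult_left_mono) auto
      then show ?thesis using div[OF that(1)] by linarith
    qed
    interpret large_exp_curve_box p a g U V T
      by unfold_locales (fact | use \<open>gcd a (int p) = 1\<close> \<open>gcd g (int p) = 1\<close> in \<open>simp add: coprime_iff_gcd_eq_1\<close>
        | use \<open>ord (int p) g = t\<close> \<open>U \<le> real t\<close> \<open>V \<le> real t\<close> in simp | erule (1) T | rule T1)+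
    have "c \<le> C1 * real p powr (\<epsilon> / 4)"
      unfolding c_def C1_def using assms by (intro harm_le_powr p_pos) simp
    then have "c\<^sup>2 \<le> (C1 * real p powr (\<epsilon> / 4))\<^sup>2"
      using c_ge_1 by (intro power_mono) auto
    also have "\<dots> = C1\<^sup>2 * real p powr (\<epsilon> / 2)"
      by (simp add: power2_eq_square powr_add[symmetric])
    finally have c2: "c\<^sup>2 \<le> C1\<^sup>2 * real p powr (\<epsilon> / 2)" .
    have err: "err1 + err2 = U powr (3 / 4) * V powr (1 / 4) / real p powr (1 / 8) + U powr (1 / 4) * V powr (5 / 8)"
      using p_pos by (simp add: err1_def err2_def monomial_def powr_minus_divide)
    have e: "err1 + err2 \<ge> 0" by (simp add: err1_def err2_def monomial_def)
    have "\<bar>real (visible_count a g p U V) - 6 / pi\<^sup>2 * (U * V / real p)\<bar> \<le> 9 * c\<^sup>2 * T * (err1 + err2)"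
      by (rule visible_count_estimate)
    also have "\<dots> \<le> 9 * (C1\<^sup>2 * real p powr (\<epsilon> / 2)) * T * (err1 + err2)"
      using c2 e T1 by (intro mult_right_mono) auto
    also have "\<dots> = 9 * C1\<^sup>2 * C2 * ((err1 + err2) * (real p powr (\<epsilon> / 2) * real p powr (\<epsilon> / 2)))"
      by (simp add: T_def mult_ac)
    also have "real p powr (\<epsilon> / 2) * real p powr (\<epsilon> / 2) = real p powr \<epsilon>"
      by (simp add: powr_add[symmetric])
    finally show "\<bar>real (visible_count a g p U V) - 6 / pi\<^sup>2 * (U * V / real p)\<bar>
      \<le> 9 * C1\<^sup>2 * C2 * ((U powr (3 / 4) * V powr (1 / 4) / real p powr (1 / 8)
              + U powr (1 / 4) * V powr (5 / 8)) * real p powr \<epsilon>)"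
      unfolding err .
  qed
qed

end
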